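(* For all $x,y\in\mathbb Z$, the annihilation operators $a_x:=T\psi(S_x\sigma_-^{(x)})\in\widehat{\mathfrak A}$ and creation operators $a_x^*:=(a_x)^*$ satisfy, in $\widehat{\mathfrak A}$, $$a_x^*=T\psi(S_x\sigma_+^{(x)}),\qquad \{a_x,a_y\}=0,\qquad \{a_x,a_y^*\}=\delta_{xy}\,1.$$
   Context: Spin algebra. $\mathrm{Fin}(\mathbb Z)$ is the set of nonempty finite subsets of $\mathbb Z$, directed by inclusion. For each $x\in\mathbb Z$, $\mathfrak A_x$ is a unital C*-algebra with identity $1_{\{x\}}$ and a fixed *-isomorphism $\xi_x:\mathfrak A_x\to\mathbb C^{2\times2}$. For $\Lambda=\{x_1<\dots<x_n\}\in\mathrm{Fin}(\mathbb Z)$, $\mathfrak A_\Lambda=\mathfrak A_{x_1}\odot\cdots\odot\mathfrak A_{x_n}$ is the algebraic tensor product with factorwise multiplication and involution and its unique C*-norm (so $\mathfrak A_\Lambda\cong\mathbb C^{2^n\times2^n}$). For $\Lambda\subseteq\Lambda'$, $\varphi_{\Lambda',\Lambda}:\mathfrak A_\Lambda\to\mathfrak A_{\Lambda'}$ is the unital injective *-homomorphism inserting $1_{\{x\}}$ in the tensor slots $x\in\Lambda'\setminus\Lambda$. $\mathfrak A$ is the infinite tensor product, i.e., the C*-inductive limit of $(\mathfrak A_\Lambda,\varphi_{\Lambda',\Lambda})$: a unital C*-algebra with unital C*-subalgebras $\widetilde{\mathfrak A}_\Lambda$ and *-isomorphisms $\varphi_\Lambda:\mathfrak A_\Lambda\to\widetilde{\mathfrak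 A}_\Lambda$ such that $\varphi_{\Lambda'}\circ\varphi_{\Lambda',\Lambda}=\varphi_\Lambda$ for $\Lambda\subseteq\Lambda'$ and $\bigcup_\Lambda\widetilde{\mathfrak A}_\Lambda$ is dense in $\mathfrak A$. Spins. $\sigma_1,\sigma_2,\sigma_3$ are the Pauli matrices, $\sigma_0=1_2$, and $\sigma_\kappa^{(x)}:=\varphi_{\{x\}}(\xi_x^{-1}(\sigma_\kappa))\in\mathfrak A$ for $x\in\mathbb Z$, $\kappa\in\{0,1,2,3\}$. $\sigma_\pm^{(x)}:=\frac12(\sigma_1^{(x)}\pm i\sigma_2^{(x)})$. $S_x:=\prod_{y=1}^{x-1}\sigma_3^{(y)}$ if $x\ge2$, $S_1:=1$, $S_x:=\prod_{y=x}^{0}\sigma_3^{(y)}$ if $x\le0$. $\Theta'$ is the *-automorphism of $\mathfrak A$ with $\Theta'(\sigma_\kappa^{(x)})=\sigma_\kappa^{(x)}$ if $x\ge1$ and $\Theta'(\sigma_\kappa^{(x)})=\varepsilon_\kappa\sigma_\kappa^{(x)}$ if $x\le0$, where $\varepsilon_0=\varepsilon_3=1$, $\varepsilon_1=\varepsilon_2=-1$; it satisfies $\Theta'^2=1$. Extension. $\widehat{\mathfrak A}:=\left\{\begin{bmatrix}A&B\\\Theta'(B)&\Theta'(A)\end{bmatrix}:A,B\in\mathfrak A\right\}$, a unital C*-subalgebra of the C*-algebra $\mathfrak A^{2\times2}$ of $2\times2$ matrices over $\mathfrak A$. $\psi:\mathfrak A\to\widehat{\mathfrak A}$, $\psi(A):=\begin{bmatrix}A&0\\0&\Theta'(A)\end{bmatrix}$,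 and $T:=\begin{bmatrix}0&1\\1&0\end{bmatrix}\in\widehat{\mathfrak A}$. $\{A,B\}:=AB+BA$. *)

theory Defs
  imports
    "HOL-Analysis.Analysis"
    "HOL-Algebra.QuotRing"
    "HOL-Algebra.Module"
    "HOL-Decision_Procs.Algebra_Aux"
begin

record 'a star_alg = "(complex, 'a) module" +
  adj :: "'a \<Rightarrow> 'a"

record 'a cstar_alg = "'a star_alg" +
  nrm :: "'a \<Rightarrow> real"

locale unital_star_algebra =
  ring M + module "cring_class_ops :: complex ring" M
  for M :: "('a, 'm) star_alg_scheme" (structure) +
  assumes smult_mult_left:
      "\<lbrakk>x \<in> carrier M; y \<in> carrier M\<rbrakk> \<Longrightarrow> (c \<odot> x) \<otimes> y = c \<odot> (x \<otimes> y)"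
    and smult_mult_right:
      "\<lbrakk>x \<in> carrier M; y \<in> carrier M\<rbrakk> \<Longrightarrow> x \<otimes> (c \<odot> y) = c \<odot> (x \<otimes> y)"
    and adj_closed: "x \<in> carrier M \<Longrightarrow> adj M x \<in> carrier M"
    and adj_adj: "x \<in> carrier M \<Longrightarrow> adj M (adj M x) = x"
    and adj_add:
      "\<lbrakk>x \<in> carrier M; y \<in> carrier M\<rbrakk> \<Longrightarrow> adj M (x \<oplus> y) = adj M x \<oplus> adj M y"
    and adj_smult: "x \<in> carrier M \<Longrightarrow> adj M (c \<odot> x) = cnj c \<odot> adj M x"
    and adj_mult:
      "\<lbrakk>x \<in> carrier M; y \<in> carrier M\<rbrakk> \<Longrightarrow> adj M (x \<otimes> y) = adj M y \<otimes> adj M x"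

locale unital_cstar_algebra =
  unital_star_algebra M for M :: "('a, 'm) cstar_alg_scheme" (structure) +
  assumes nrm_nonneg: "x \<in> carrier M \<Longrightarrow> 0 \<le> nrm M x"
    and nrm_eq_0: "x \<in> carrier M \<Longrightarrow> nrm M x = 0 \<longleftrightarrow> x = \<zero>"
    and nrm_triangle:
      "\<lbrakk>x \<in> carrier M; y \<in> carrier M\<rbrakk> \<Longrightarrow> nrm M (x \<oplus> y) \<le> nrm M x + nrm M y"
    and nrm_smult: "x \<in> carrier M \<Longrightarrow> nrm M (c \<odot> x) = cmod c * nrm M x"
    and nrm_mult:
      "\<lbrakk>x \<in> carrier M; y \<in> carrier M\<rbrakk> \<Longrightarrow> nrm M (x \<otimes> y) \<le> nrm M x * nrm M y"
    and cstar_identity: "x \<in> carrier M \<Longrightarrow> nrm M (adj M x \<otimes> x) = (nrm M x)\<^sup>2"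
    and complete:
      "\<lbrakk>\<And>n :: nat. s n \<in> carrier M;
        \<forall>e>0. \<exists>N. \<forall>m\<ge>N. \<forall>n\<ge>N. nrm M (s m \<ominus> s n) < e\<rbrakk>
       \<Longrightarrow> \<exists>l\<in>carrier M. (\<lambda>n. nrm M (s n \<ominus> l)) \<longlonglongrightarrow> 0"

text \<open>The requirement that the substructure is itself a C*-algebra entails that \<open>L\<close> is
  norm closed; since it keeps the \<open>one\<close> field, the subalgebra contains the unit of \<open>M\<close>.\<close>

definition unital_cstar_subalgebra :: "'a set \<Rightarrow> 'a cstar_alg \<Rightarrow> bool" where
  "unital_cstar_subalgebra L M \<longleftrightarrow>
     L \<subseteq> carrier M \<and> unital_cstar_algebra (M\<lparr>carrier := L\<rparr>)"

definition star_hom ::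
  "('a, 'm) star_alg_scheme \<Rightarrow> ('b, 'n) star_alg_scheme \<Rightarrow> ('a \<Rightarrow> 'b) set" where
  "star_hom M N = {h \<in> ring_hom M N.
     (\<forall>c. \<forall>x\<in>carrier M. h (c \<odot>\<^bsub>M\<^esub> x) = c \<odot>\<^bsub>N\<^esub> h x) \<and>
     (\<forall>x\<in>carrier M. h (adj M x) = adj N (h x))}"

definition star_iso ::
  "('a, 'm) star_alg_scheme \<Rightarrow> ('b, 'n) star_alg_scheme \<Rightarrow> ('a \<Rightarrow> 'b) set" where
  "star_iso M N = {h \<in> star_hom M N. bij_betw h (carrier M) (carrier N)}"

definition add_nrm :: "'a star_alg \<Rightarrow> ('a \<Rightarrow> real) \<Rightarrow> 'a cstar_alg" where
  "add_nrm M n = \<lparr>carrier = carrier M, mult = mult M, one = one M, zero = zero M,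
     add = add M, smult = smult M, adj = adj M, nrm = n\<rparr>"

text \<open>A *-algebra carries at most one norm that makes it a C*-algebra.  The values of the norm
  off the carrier are normalised by \<^const>\<open>extensional\<close>, so that it is unique as a function.\<close>

definition cstar_norm :: "'a star_alg \<Rightarrow> 'a \<Rightarrow> real" where
  "cstar_norm M = (THE n. n \<in> extensional (carrier M) \<and> unital_cstar_algebra (add_nrm M n))"

definition cstar_of :: "'a star_alg \<Rightarrow> 'a cstar_alg" where
  "cstar_of M = add_nrm M (cstar_norm M)"

definition complex_matrices :: "(complex^'n^'n) cstar_alg" where
  "complex_matrices = \<lparr>carrier = UNIV, mult = (**), one = mat 1, zero = 0, add = (+),
     smult = (\<lambda>c X. \<chi> i j. c * X $ i $ j), adj = (\<lambda>X. \<chi> i j. cnj (X $ j $ i)),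
     nrm = (\<lambda>X. onorm ((*v) X))\<rparr>"

definition matrices_over :: "('a, 'm) star_alg_scheme \<Rightarrow> ('a^'n^'n) star_alg" where
  "matrices_over M = \<lparr>carrier = {X. \<forall>i j. X $ i $ j \<in> carrier M},
     mult = (\<lambda>X Y. \<chi> i j. \<Oplus>\<^bsub>M\<^esub>k\<in>UNIV. X $ i $ k \<otimes>\<^bsub>M\<^esub> Y $ k $ j),
     one = (\<chi> i j. if i = j then \<one>\<^bsub>M\<^esub> else \<zero>\<^bsub>M\<^esub>),
     zero = (\<chi> i j. \<zero>\<^bsub>M\<^esub>),
     add = (\<lambda>X Y. \<chi> i j. X $ i $ j \<oplus>\<^bsub>M\<^esub> Y $ i $ j),
     smult = (\<lambda>c X. \<chi> i j. c \<odot>\<^bsub>M\<^esub> X $ i $ j),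
     adj = (\<lambda>X. \<chi> i j. adj M (X $ j $ i))\<rparr>"

definition mat2 :: "'a \<Rightarrow> 'a \<Rightarrow> 'a \<Rightarrow> 'a \<Rightarrow> 'a^2^2" where
  "mat2 a b c d =
     (\<chi> i j. if i = 1 then (if j = 1 then a else b) else (if j = 1 then c else d))"

text \<open>The tensor product of the algebras \<open>A i\<close>, \<open>i \<in> I\<close>, is the quotient of the free complex
  vector space on the product of the carriers by the relations of multilinearity.  Vectors of the
  free space are finitely supported functions.\<close>

definition ktuples :: "('i \<Rightarrow> 'b cstar_alg) \<Rightarrow> 'i set \<Rightarrow> ('i \<Rightarrow> 'b) set" where
  "ktuples A I = (\<Pi>\<^sub>E i\<in>I. carrier (A i))"

definition basis_vec :: "'k \<Rightarrow> 'k \<Rightarrow> complex" where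
  "basis_vec f = (\<lambda>h. if h = f then 1 else 0)"

text \<open>Sends \<open>basis_vec f\<close> to \<open>basis_vec (g f)\<close>, extended linearly to finitely supported functions.\<close>

definition pushforward :: "('k \<Rightarrow> 'l) \<Rightarrow> ('k \<Rightarrow> complex) \<Rightarrow> 'l \<Rightarrow> complex" where
  "pushforward g u = (\<lambda>h. \<Sum>f | u f \<noteq> 0 \<and> g f = h. u f)"

definition free_tensors ::
  "('i \<Rightarrow> 'b cstar_alg) \<Rightarrow> 'i set \<Rightarrow> (('i \<Rightarrow> 'b) \<Rightarrow> complex) star_alg" where
  "free_tensors A I = \<lparr>carrier = {u. finite {f. u f \<noteq> 0} \<and> {f. u f \<noteq> 0} \<subseteq> ktuples A I},
     mult = (\<lambda>u v h. \<Sum>(f, g) | u f \<noteq> 0 \<and> v g \<noteq> 0 \<and> (\<lambda>i\<in>I. f i \<otimes>\<^bsub>A i\<^esub> g i) = h. u f * v g),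
     one = basis_vec (\<lambda>i\<in>I. \<one>\<^bsub>A i\<^esub>),
     zero = (\<lambda>h. 0),
     add = (\<lambda>u v h. u h + v h),
     smult = (\<lambda>c u h. c * u h),
     adj = (\<lambda>u. pushforward (\<lambda>f. \<lambda>i\<in>I. adj (A i) (f i)) (\<lambda>f. cnj (u f)))\<rparr>"

inductive_set null_tensors ::
  "('i \<Rightarrow> 'b cstar_alg) \<Rightarrow> 'i set \<Rightarrow> (('i \<Rightarrow> 'b) \<Rightarrow> complex) set"
  for A I where
  null_zero: "(\<lambda>h. 0) \<in> null_tensors A I"
| null_additive:
    "\<lbrakk>f \<in> ktuples A I; i \<in> I; a \<in> carrier (A i); b \<in> carrier (A i)\<rbrakk> \<Longrightarrow>
     (\<lambda>h. basis_vec (f(i := a \<oplus>\<^bsub>A i\<^esub> b)) h - basis_vec (f(i := a)) h - basis_vec (f(i := b)) h)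
       \<in> null_tensors A I"
| null_homogeneous:
    "\<lbrakk>f \<in> ktuples A I; i \<in> I; a \<in> carrier (A i)\<rbrakk> \<Longrightarrow>
     (\<lambda>h. basis_vec (f(i := c \<odot>\<^bsub>A i\<^esub> a)) h - c * basis_vec (f(i := a)) h) \<in> null_tensors A I"
| null_add:
    "\<lbrakk>u \<in> null_tensors A I; v \<in> null_tensors A I\<rbrakk> \<Longrightarrow> (\<lambda>h. u h + v h) \<in> null_tensors A I"
| null_smult: "u \<in> null_tensors A I \<Longrightarrow> (\<lambda>h. c * u h) \<in> null_tensors A I"

definition tensor_class ::
  "('i \<Rightarrow> 'b cstar_alg) \<Rightarrow> 'i set \<Rightarrow> (('i \<Rightarrow> 'b) \<Rightarrow> complex) \<Rightarrow> (('i \<Rightarrow> 'b) \<Rightarrow> complex) set" where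
  "tensor_class A I u = null_tensors A I +>\<^bsub>free_tensors A I\<^esub> u"

text \<open>The ring structure on cosets is the library's quotient ring; scalar multiplication and
  involution are induced in the same style (the union over representatives of a coset is again a
  single coset).\<close>

definition tensor_star_algebra ::
  "('i \<Rightarrow> 'b cstar_alg) \<Rightarrow> 'i set \<Rightarrow> (('i \<Rightarrow> 'b) \<Rightarrow> complex) set star_alg" where
  "tensor_star_algebra A I = (let Q = free_tensors A I Quot null_tensors A I in
     \<lparr>carrier = carrier Q, mult = mult Q, one = one Q, zero = zero Q, add = add Q,
      smult = (\<lambda>c X. \<Union>u\<in>X. tensor_class A I (c \<odot>\<^bsub>free_tensors A I\<^esub> u)),
      adj = (\<lambda>X. \<Union>u\<in>X. tensor_class A I (adj (free_tensors A I) u))\<rparr>)"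

definition tensor_algebra ::
  "('i \<Rightarrow> 'b cstar_alg) \<Rightarrow> 'i set \<Rightarrow> (('i \<Rightarrow> 'b) \<Rightarrow> complex) set cstar_alg" where
  "tensor_algebra A I = cstar_of (tensor_star_algebra A I)"

definition simple_tensor ::
  "('i \<Rightarrow> 'b cstar_alg) \<Rightarrow> 'i set \<Rightarrow> ('i \<Rightarrow> 'b) \<Rightarrow> (('i \<Rightarrow> 'b) \<Rightarrow> complex) set" where
  "simple_tensor A I f = tensor_class A I (basis_vec (restrict f I))"

text \<open>For \<open>I \<subseteq> J\<close>: units are inserted in the slots \<open>J - I\<close>.\<close>

definition insert_units ::
  "('i \<Rightarrow> 'b cstar_alg) \<Rightarrow> 'i set \<Rightarrow> 'i set \<Rightarrow>
   (('i \<Rightarrow> 'b) \<Rightarrow> complex) set \<Rightarrow> (('i \<Rightarrow> 'b) \<Rightarrow> complex) set" where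
  "insert_units A J I X = (\<Union>u\<in>X. tensor_class A J
     (pushforward (\<lambda>f. \<lambda>j\<in>J. if j \<in> I then f j else \<one>\<^bsub>A j\<^esub>) u))"

definition Fin_Z :: "int set set" where
  "Fin_Z = {\<Lambda>. finite \<Lambda> \<and> \<Lambda> \<noteq> {}}"

text \<open>\<open>AA\<close> together with the local subalgebras \<open>L \<Lambda>\<close> and the isomorphisms \<open>\<phi> \<Lambda>\<close> is an inductive
  limit of the local tensor products of the site algebras \<open>A x\<close>.\<close>

locale spin_algebra =
  fixes A :: "int \<Rightarrow> 'b cstar_alg"
    and \<xi> :: "int \<Rightarrow> 'b \<Rightarrow> complex^2^2"
    and AA :: "'a cstar_alg"
    and L :: "int set \<Rightarrow> 'a set"
    and \<phi> :: "int set \<Rightarrow> ((int \<Rightarrow> 'b) \<Rightarrow> complex) set \<Rightarrow> 'a"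
  assumes site_algebra: "unital_cstar_algebra (A x)"
    and site_iso: "\<xi> x \<in> star_iso (A x) complex_matrices"
    and spin_cstar: "unital_cstar_algebra AA"
    and local_subalgebra: "\<Lambda> \<in> Fin_Z \<Longrightarrow> unital_cstar_subalgebra (L \<Lambda>) AA"
    and local_iso:
      "\<Lambda> \<in> Fin_Z \<Longrightarrow> \<phi> \<Lambda> \<in> star_iso (tensor_algebra A \<Lambda>) (AA\<lparr>carrier := L \<Lambda>\<rparr>)"
    and compatible:
      "\<lbrakk>\<Lambda> \<in> Fin_Z; \<Lambda>' \<in> Fin_Z; \<Lambda> \<subseteq> \<Lambda>'; X \<in> carrier (tensor_algebra A \<Lambda>)\<rbrakk>
       \<Longrightarrow> \<phi> \<Lambda>' (insert_units A \<Lambda>' \<Lambda> X) = \<phi> \<Lambda> X"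
    and local_dense:
      "\<lbrakk>a \<in> carrier AA; e > 0\<rbrakk> \<Longrightarrow> \<exists>\<Lambda>\<in>Fin_Z. \<exists>b\<in>L \<Lambda>. nrm AA (a \<ominus>\<^bsub>AA\<^esub> b) < e"

definition pauli :: "nat \<Rightarrow> complex^2^2" where
  "pauli \<kappa> =
     (if \<kappa> = 1 then mat2 0 1 1 0
      else if \<kappa> = 2 then mat2 0 (- \<i>) \<i> 0
      else if \<kappa> = 3 then mat2 1 0 0 (- 1)
      else mat 1)"

text \<open>An element of the site algebra \<open>A x\<close> is regarded as a one-fold tensor.\<close>

definition spin ::
  "(int \<Rightarrow> 'b cstar_alg) \<Rightarrow> (int \<Rightarrow> 'b \<Rightarrow> complex^2^2) \<Rightarrow>
   (int set \<Rightarrow> ((int \<Rightarrow> 'b) \<Rightarrow> complex) set \<Rightarrow> 'a) \<Rightarrow> nat \<Rightarrow> int \<Rightarrow> 'a" where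
  "spin A \<xi> \<phi> \<kappa> x =
     \<phi> {x} (simple_tensor A {x} (\<lambda>_. inv_into (carrier (A x)) (\<xi> x) (pauli \<kappa>)))"

definition spin_plus :: "'a cstar_alg \<Rightarrow> (nat \<Rightarrow> int \<Rightarrow> 'a) \<Rightarrow> int \<Rightarrow> 'a" where
  "spin_plus AA \<sigma> x = (1/2) \<odot>\<^bsub>AA\<^esub> (\<sigma> 1 x \<oplus>\<^bsub>AA\<^esub> \<i> \<odot>\<^bsub>AA\<^esub> \<sigma> 2 x)"

definition spin_minus :: "'a cstar_alg \<Rightarrow> (nat \<Rightarrow> int \<Rightarrow> 'a) \<Rightarrow> int \<Rightarrow> 'a" where
  "spin_minus AA \<sigma> x = (1/2) \<odot>\<^bsub>AA\<^esub> (\<sigma> 1 x \<ominus>\<^bsub>AA\<^esub> \<i> \<odot>\<^bsub>AA\<^esub> \<sigma> 2 x)"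

text \<open>Ordered product; \<open>finprod\<close> needs a commutative monoid, whereas here only the factors commute.\<close>

definition list_prod :: "('a, 'm) monoid_scheme \<Rightarrow> 'a list \<Rightarrow> 'a" where
  "list_prod M as = foldr (mult M) as (one M)"

definition spin_string :: "'a cstar_alg \<Rightarrow> (nat \<Rightarrow> int \<Rightarrow> 'a) \<Rightarrow> int \<Rightarrow> 'a" where
  "spin_string AA \<sigma> x =
     (if x \<ge> 2 then list_prod AA (map (\<sigma> 3) [1..x-1])
      else if x = 1 then \<one>\<^bsub>AA\<^esub>
      else list_prod AA (map (\<sigma> 3) [x..0]))"

definition spin_sign :: "nat \<Rightarrow> complex" where
  "spin_sign \<kappa> = (if \<kappa> = 0 \<or> \<kappa> = 3 then 1 else - 1)"

text \<open>By density of the local algebras, \<open>\<Theta>\<close> is determined by these conditions on the carrier.\<close>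

definition half_rotation ::
  "'a cstar_alg \<Rightarrow> (nat \<Rightarrow> int \<Rightarrow> 'a) \<Rightarrow> ('a \<Rightarrow> 'a) \<Rightarrow> bool" where
  "half_rotation AA \<sigma> \<Theta> \<longleftrightarrow> \<Theta> \<in> star_iso AA AA \<and>
     (\<forall>x. \<forall>\<kappa>\<in>{0, 1, 2, 3}.
        \<Theta> (\<sigma> \<kappa> x) = (if x \<ge> 1 then \<sigma> \<kappa> x else spin_sign \<kappa> \<odot>\<^bsub>AA\<^esub> \<sigma> \<kappa> x))"

definition extended_algebra :: "'a cstar_alg \<Rightarrow> ('a \<Rightarrow> 'a) \<Rightarrow> ('a^2^2) cstar_alg" where
  "extended_algebra AA \<Theta> = (cstar_of (matrices_over AA))
     \<lparr>carrier := {mat2 a b (\<Theta> b) (\<Theta> a) | a b. a \<in> carrier AA \<and> b \<in> carrier AA}\<rparr>"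

definition ext_psi :: "'a cstar_alg \<Rightarrow> ('a \<Rightarrow> 'a) \<Rightarrow> 'a \<Rightarrow> 'a^2^2" where
  "ext_psi AA \<Theta> a = mat2 a \<zero>\<^bsub>AA\<^esub> \<zero>\<^bsub>AA\<^esub> (\<Theta> a)"

definition ext_T :: "'a cstar_alg \<Rightarrow> 'a^2^2" where
  "ext_T AA = mat2 \<zero>\<^bsub>AA\<^esub> \<one>\<^bsub>AA\<^esub> \<one>\<^bsub>AA\<^esub> \<zero>\<^bsub>AA\<^esub>"

definition annihilation ::
  "'a cstar_alg \<Rightarrow> ('a \<Rightarrow> 'a) \<Rightarrow> (nat \<Rightarrow> int \<Rightarrow> 'a) \<Rightarrow> int \<Rightarrow> 'a^2^2" where
  "annihilation AA \<Theta> \<sigma> x = ext_T AA \<otimes>\<^bsub>extended_algebra AA \<Theta>\<^esub>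
     ext_psi AA \<Theta> (spin_string AA \<sigma> x \<otimes>\<^bsub>AA\<^esub> spin_minus AA \<sigma> x)"

definition creation ::
  "'a cstar_alg \<Rightarrow> ('a \<Rightarrow> 'a) \<Rightarrow> (nat \<Rightarrow> int \<Rightarrow> 'a) \<Rightarrow> int \<Rightarrow> 'a^2^2" where
  "creation AA \<Theta> \<sigma> x = adj (extended_algebra AA \<Theta>) (annihilation AA \<Theta> \<sigma> x)"

definition anticommutator :: "('a, 'm) ring_scheme \<Rightarrow> 'a \<Rightarrow> 'a \<Rightarrow> 'a" where
  "anticommutator M a b = (a \<otimes>\<^bsub>M\<^esub> b) \<oplus>\<^bsub>M\<^esub> (b \<otimes>\<^bsub>M\<^esub> a)"

end

theory Submission
  imports Defs
begin

text \<open>Say that \<open>a\<close> and \<open>b\<close> commute up to \<open>\<epsilon>\<close> if \<open>a b = \<epsilon> b a\<close>.  Put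
  \<open>w\<^sub>x(c) = S\<^sub>x (\<sigma>\<^sub>1 + c \<sigma>\<^sub>2) / 2\<close> at the site \<open>x\<close>, so that \<open>c = - \<i>\<close> gives annihilation and \<open>c = \<i>\<close>
  creation, and let \<open>e\<^sub>x = 1\<close> for \<open>x \<ge> 1\<close> and \<open>e\<^sub>x = - 1\<close> otherwise.  The half rotation multiplies
  \<open>w\<^sub>x(c)\<close> by \<open>e\<^sub>x\<close>, whence \<open>T \<psi>(w\<^sub>x(c))\<close> is off-diagonal with entries \<open>e\<^sub>x w\<^sub>x(c)\<close> and \<open>w\<^sub>x(c)\<close>.
  Counting which of the strings \<open>S\<^sub>x\<close>, \<open>S\<^sub>y\<close> passes through the other site shows that \<open>w\<^sub>x(c)\<close> and
  \<open>w\<^sub>y(d)\<close> commute up to \<open>- e\<^sub>x e\<^sub>y\<close> for \<open>x \<noteq> y\<close>; the signs of the matrix entries turn this into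
  anticommutation.  For \<open>x = y\<close> the strings cancel up to \<open>e\<^sub>x\<close>, and the anticommutator is
  \<open>(1 + c d) / 2\<close>.\<close>

section \<open>Algebraic tensor products\<close>

text \<open>A member of the coset is \<open>n + u\<close> with \<open>n\<close> null, so
  \<open>n\<close> can only be the pointwise difference. This turns the library coset into a
  congruence relation.\<close>

lemma tensor_class_eq:
  "tensor_class A I u = {v. (\<lambda>h. v h - u h) \<in> null_tensors A I}"
proof (intro equalityI subsetI)
  fix v assume "v \<in> tensor_class A I u"
  then show "v \<in> {v. (\<lambda>h. v h - u h) \<in> null_tensors A I}"
    by (auto simp: tensor_class_def a_r_coset_def r_coset_def free_tensors_def)
next
  fix v assume "v \<in> {v. (\<lambda>h. v h - u h) \<in> null_tensors A I}"
  then have n: "(\<lambda>h. v h - u h) \<in> null_tensors A I" by simp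
  then show "v \<in> tensor_class A I u"
    by (auto simp: tensor_class_def a_r_coset_def r_coset_def free_tensors_def intro!: bexI[OF _ n])
qed

lemma null_uminus: "u \<in> null_tensors A I \<Longrightarrow> (\<lambda>h. - u h) \<in> null_tensors A I"
  using null_smult[of u A I "- 1"] by simp

lemma null_diff:
  "\<lbrakk>u \<in> null_tensors A I; v \<in> null_tensors A I\<rbrakk> \<Longrightarrow> (\<lambda>h. u h - v h) \<in> null_tensors A I"
  using null_add[OF _ null_uminus] by force

lemma null_sum:
  assumes "finite S" "\<And>k. k \<in> S \<Longrightarrow> T k \<in> null_tensors A I"
  shows "(\<lambda>h. \<Sum>k\<in>S. c k * T k h) \<in> null_tensors A I"
  using assms
proof (induction S rule: finite_induct)
  case empty
  show ?case by (simp add: null_zero)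
next
  case (insert k S)
  have "(\<lambda>h. c k * T k h + (\<Sum>k\<in>S. c k * T k h)) \<in> null_tensors A I"
    using insert by (intro null_add null_smult) auto
  then show ?case using insert by simp
qed

lemma tensor_class_self: "u \<in> tensor_class A I u"
  by (simp add: tensor_class_eq null_zero)

lemma tensor_class_cong:
  assumes "v \<in> tensor_class A I u"
  shows "tensor_class A I v = tensor_class A I u"
proof -
  from assms have n: "(\<lambda>h. v h - u h) \<in> null_tensors A I" by (simp add: tensor_class_eq)
  have "(\<lambda>h. w h - u h) \<in> null_tensors A I \<longleftrightarrow> (\<lambda>h. w h - v h) \<in> null_tensors A I" for w
  proof
    assume "(\<lambda>h. w h - u h) \<in> null_tensors A I"
    from null_diff[OF this n] show "(\<lambda>h. w h - v h) \<in> null_tensors A I" by simp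
  next
    assume "(\<lambda>h. w h - v h) \<in> null_tensors A I"
    from null_add[OF this n] show "(\<lambda>h. w h - u h) \<in> null_tensors A I" by simp
  qed
  then show ?thesis by (auto simp: tensor_class_eq)
qed

text \<open>Operations on the quotient are unions over all representatives. Once every
  representative lands in one class, the union collapses to it; this is how well-definedness is used
  for products, scalars, adjoints and inserted units.\<close>

lemma union_tensor_classes:
  assumes "\<And>v. v \<in> tensor_class A I u \<Longrightarrow> F v \<in> tensor_class A J w"
  shows "(\<Union>v\<in>tensor_class A I u. tensor_class A J (F v)) = tensor_class A J w"
  using assms tensor_class_cong[of _ A J w] tensor_class_self[of u A I] by blast

section \<open>Push-forward and product of finitely supported functions\<close>

lemma finite_support_basis_vec: "finite {h. basis_vec f h \<noteq> 0}"
  by (simp add: basis_vec_def)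

lemma finite_support_lincomb:
  fixes u v :: "'k \<Rightarrow> complex"
  assumes "finite {f. u f \<noteq> 0}" "finite {f. v f \<noteq> 0}"
  shows "finite {f. u f + c * v f \<noteq> 0}"
  by (rule finite_subset[OF _ finite_UnI[OF assms]]) auto

text \<open>The fibre sum is traded for a sum over a set \<open>S\<close> that does not depend on
  \<open>h\<close> and may exceed the support. Functions with different supports can then share one
  \<open>S\<close>, which makes linearity visible.\<close>

lemma pushforward_eq_sum:
  assumes "finite S" "{f. u f \<noteq> 0} \<subseteq> S"
  shows "pushforward P u = (\<lambda>h. \<Sum>f\<in>S. u f * basis_vec (P f) h)"
proof
  fix h
  have "(\<Sum>f\<in>S. u f * basis_vec (P f) h) = (\<Sum>f | u f \<noteq> 0 \<and> P f = h. u f * basis_vec (P f) h)"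
    using assms by (intro sum.mono_neutral_right) (auto simp: basis_vec_def)
  also have "\<dots> = pushforward P u h"
    unfolding pushforward_def by (intro sum.cong) (auto simp: basis_vec_def)
  finally show "pushforward P u h = (\<Sum>f\<in>S. u f * basis_vec (P f) h)" by simp
qed

lemma pushforward_basis_vec: "pushforward P (basis_vec f) = basis_vec (P f)"
  by (subst pushforward_eq_sum[of "{f}"]) (auto simp: basis_vec_def)

lemma pushforward_lincomb:
  assumes "finite {f. u f \<noteq> 0}" "finite {f. v f \<noteq> 0}"
  shows "pushforward P (\<lambda>f. u f + c * v f) = (\<lambda>h. pushforward P u h + c * pushforward P v h)"
proof -
  let ?S = "{f. u f \<noteq> 0} \<union> {f. v f \<noteq> 0}"
  have fin: "finite ?S" using assms by simp
  show ?thesis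
    by (subst (1 2 3) pushforward_eq_sum[OF fin])
      (auto simp: sum.distrib sum_distrib_left algebra_simps)
qed

lemma pushforward_diff:
  assumes "finite {f. u f \<noteq> 0}" "finite {f. v f \<noteq> 0}"
  shows "pushforward P (\<lambda>f. u f - v f) = (\<lambda>h. pushforward P u h - pushforward P v h)"
  using pushforward_lincomb[OF assms, of P "- 1"] by simp

definition tuple_mult :: "('i \<Rightarrow> 'b cstar_alg) \<Rightarrow> 'i set \<Rightarrow> ('i \<Rightarrow> 'b) \<Rightarrow> ('i \<Rightarrow> 'b) \<Rightarrow> 'i \<Rightarrow> 'b" where
  "tuple_mult A I f g = (\<lambda>i\<in>I. f i \<otimes>\<^bsub>A i\<^esub> g i)"

lemma free_mult_eq_sum:
  assumes "finite S" "{f. u f \<noteq> 0} \<subseteq> S" "finite T" "{g. v g \<noteq> 0} \<subseteq> T"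
  shows "mult (free_tensors A I) u v =
    (\<lambda>h. \<Sum>f\<in>S. \<Sum>g\<in>T. u f * v g * basis_vec (tuple_mult A I f g) h)"
proof
  fix h
  have "(\<Sum>f\<in>S. \<Sum>g\<in>T. u f * v g * basis_vec (tuple_mult A I f g) h) =
      (\<Sum>(f, g)\<in>S \<times> T. u f * v g * basis_vec (tuple_mult A I f g) h)"
    by (simp add: sum.cartesian_product)
  also have "\<dots> = (\<Sum>(f, g) | u f \<noteq> 0 \<and> v g \<noteq> 0 \<and> tuple_mult A I f g = h.
      u f * v g * basis_vec (tuple_mult A I f g) h)"
    using assms by (intro sum.mono_neutral_right) (auto simp: basis_vec_def split: if_splits)
  also have "\<dots> = mult (free_tensors A I) u v h"
    unfolding free_tensors_def by (auto simp: tuple_mult_def basis_vec_def intro!: sum.cong)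
  finally show "mult (free_tensors A I) u v h =
    (\<Sum>f\<in>S. \<Sum>g\<in>T. u f * v g * basis_vec (tuple_mult A I f g) h)" by simp
qed

text \<open>For a fixed tuple \<open>g\<close> on the right, multiplication acts on \<open>u\<close>
  as a push-forward. The product is a linear combination of these, so nullity of \<open>u\<close>
  can be passed on term by term.\<close>

lemma free_mult_eq_left:
  assumes "finite {f. u f \<noteq> 0}" "finite {g. v g \<noteq> 0}"
  shows "mult (free_tensors A I) u v =
    (\<lambda>h. \<Sum>g | v g \<noteq> 0. v g * pushforward (\<lambda>f. tuple_mult A I f g) u h)"
  by (subst free_mult_eq_sum[OF assms(1) subset_refl assms(2) subset_refl],
      subst pushforward_eq_sum[OF assms(1) subset_refl], subst sum.swap)
    (simp add: sum_distrib_left algebra_simps)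

lemma free_mult_eq_right:
  assumes "finite {f. u f \<noteq> 0}" "finite {g. v g \<noteq> 0}"
  shows "mult (free_tensors A I) u v =
    (\<lambda>h. \<Sum>f | u f \<noteq> 0. u f * pushforward (tuple_mult A I f) v h)"
  by (subst free_mult_eq_sum[OF assms(1) subset_refl assms(2) subset_refl],
      subst pushforward_eq_sum[OF assms(2) subset_refl])
    (simp add: sum_distrib_left algebra_simps)

lemma free_mult_basis_vec_left:
  assumes "finite {g. v g \<noteq> 0}"
  shows "mult (free_tensors A I) (basis_vec f) v = pushforward (tuple_mult A I f) v"
proof -
  have "{h. basis_vec f h \<noteq> 0} = {f}" by (auto simp: basis_vec_def)
  then show ?thesis
    using free_mult_eq_right[OF finite_support_basis_vec assms, of A I f] by (simp add: basis_vec_def)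
qed

section \<open>Operations on tensors respect the null relations\<close>

definition slotwise ::
  "'i set \<Rightarrow> 'i set \<Rightarrow> ('i \<Rightarrow> 'b \<Rightarrow> 'b) \<Rightarrow> ('i \<Rightarrow> 'b) \<Rightarrow> ('i \<Rightarrow> 'b) \<Rightarrow> 'i \<Rightarrow> 'b" where
  "slotwise I J p w f = (\<lambda>j\<in>J. if j \<in> I then p j (f j) else w j)"

locale algebra_family =
  fixes A :: "'i \<Rightarrow> 'b cstar_alg"
  assumes family_algebra: "unital_star_algebra (A i)"
begin

lemma family_ring: "ring (A i)"
  using family_algebra unital_star_algebra.axioms(1) by blast

lemma family_module: "module (cring_class_ops :: complex ring) (A i)"
  using family_algebra unital_star_algebra.axioms(2) by blast

lemma family_smult_closed: "a \<in> carrier (A i) \<Longrightarrow> c \<odot>\<^bsub>A i\<^esub> a \<in> carrier (A i)"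
  using module.smult_closed[OF family_module] by (simp add: cring_class_ops_def)

lemma fun_upd_ktuples:
  "\<lbrakk>f \<in> ktuples A I; i \<in> I; a \<in> carrier (A i)\<rbrakk> \<Longrightarrow> f(i := a) \<in> ktuples A I"
  by (auto simp: ktuples_def PiE_iff extensional_def)

text \<open>Each generator lives on at most three tuples of carrier elements, and sums and multiples
  preserve this. Finiteness is what linearity of \<open>pushforward\<close> requires.\<close>

lemma null_support:
  assumes "u \<in> null_tensors A I"
  shows "finite {f. u f \<noteq> 0} \<and> {f. u f \<noteq> 0} \<subseteq> ktuples A I"
  using assms
proof (induction rule: null_tensors.induct)
  case null_zero
  show ?case by simp
next
  case (null_additive f i a b)
  let ?S = "{f(i := a \<oplus>\<^bsub>A i\<^esub> b), f(i := a), f(i := b)}"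
  have "?S \<subseteq> ktuples A I"
    using null_additive ring.ring_simprules(1)[OF family_ring] fun_upd_ktuples by auto
  moreover have "{h. basis_vec (f(i := a \<oplus>\<^bsub>A i\<^esub> b)) h - basis_vec (f(i := a)) h
      - basis_vec (f(i := b)) h \<noteq> 0} \<subseteq> ?S"
    by (auto simp: basis_vec_def)
  ultimately show ?case by (meson finite.emptyI finite.insertI finite_subset subset_trans)
next
  case (null_homogeneous f i a c)
  let ?S = "{f(i := c \<odot>\<^bsub>A i\<^esub> a), f(i := a)}"
  have "?S \<subseteq> ktuples A I"
    using null_homogeneous family_smult_closed fun_upd_ktuples by auto
  moreover have "{h. basis_vec (f(i := c \<odot>\<^bsub>A i\<^esub> a)) h - c * basis_vec (f(i := a)) h \<noteq> 0} \<subseteq> ?S"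
    by (auto simp: basis_vec_def)
  ultimately show ?case by (meson finite.emptyI finite.insertI finite_subset subset_trans)
next
  case (null_add u v)
  have "{h. u h + v h \<noteq> 0} \<subseteq> {h. u h \<noteq> 0} \<union> {h. v h \<noteq> 0}" by auto
  with null_add show ?case by (meson finite_UnI finite_subset le_sup_iff subset_trans)
next
  case (null_smult u c)
  have "{h. c * u h \<noteq> 0} \<subseteq> {h. u h \<noteq> 0}" by auto
  with null_smult show ?case by (meson finite_subset subset_trans)
qed

lemma tensor_class_support:
  assumes "v \<in> tensor_class A I (basis_vec f)" "f \<in> ktuples A I"
  shows "finite {g. v g \<noteq> 0}" "{g. v g \<noteq> 0} \<subseteq> ktuples A I"
proof -
  let ?n = "\<lambda>h. v h - basis_vec f h"
  have "?n \<in> null_tensors A I" using assms(1) by (simp add: tensor_class_eq)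
  from null_support[OF this]
  have n: "finite {h. ?n h \<noteq> 0}" "{h. ?n h \<noteq> 0} \<subseteq> ktuples A I" by auto
  have "{h. v h \<noteq> 0} \<subseteq> {h. ?n h \<noteq> 0} \<union> {f}" by (auto simp: basis_vec_def)
  with n assms(2) show "finite {g. v g \<noteq> 0}" "{g. v g \<noteq> 0} \<subseteq> ktuples A I"
    by (auto intro: finite_subset)
qed

text \<open>A slotwise map that is additive and \<tau>-homogeneous in each slot of \<open>I\<close>
  sends generating relations to generating relations. One induction thus serves multiplication by a
  fixed tuple, insertion of units (\<tau> the identity) and the antilinear involution (\<tau>
  conjugation).\<close>

lemma pushforward_null:
  assumes \<tau>: "\<tau> = (\<lambda>z. z) \<or> \<tau> = cnj"
    and "I \<subseteq> J"
    and p_closed: "\<And>i a. \<lbrakk>i \<in> I; a \<in> carrier (A i)\<rbrakk> \<Longrightarrow> p i a \<in> carrier (A i)"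
    and p_add: "\<And>i a b. \<lbrakk>i \<in> I; a \<in> carrier (A i); b \<in> carrier (A i)\<rbrakk>
        \<Longrightarrow> p i (a \<oplus>\<^bsub>A i\<^esub> b) = p i a \<oplus>\<^bsub>A i\<^esub> p i b"
    and p_smult: "\<And>i a c. \<lbrakk>i \<in> I; a \<in> carrier (A i)\<rbrakk>
        \<Longrightarrow> p i (c \<odot>\<^bsub>A i\<^esub> a) = \<tau> c \<odot>\<^bsub>A i\<^esub> p i a"
    and w: "\<And>j. j \<in> J - I \<Longrightarrow> w j \<in> carrier (A j)"
    and "u \<in> null_tensors A I"
  shows "pushforward (slotwise I J p w) (\<lambda>f. \<tau> (u f)) \<in> null_tensors A J"
  using \<open>u \<in> null_tensors A I\<close>
proof (induction rule: null_tensors.induct)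
  let ?P = "slotwise I J p w"
  have P_ktuples: "?P f \<in> ktuples A J" if "f \<in> ktuples A I" for f
    using that w p_closed by (auto simp: slotwise_def ktuples_def PiE_mem[of _ I "\<lambda>i. carrier (A i)"])
  \<comment> \<open>Changing slot \<open>i\<close> of the input changes only slot \<open>i\<close>
    of the image, so a relation in slot \<open>i\<close> stays a relation in slot
    \<open>i\<close>.\<close>
  have P_upd: "?P (f(i := a)) = (?P f)(i := p i a)" if "i \<in> I" for f i a
    using that \<open>I \<subseteq> J\<close> by (auto simp: slotwise_def fun_eq_iff)
  have \<tau>_simps: "\<tau> 0 = 0" "\<tau> (x + y) = \<tau> x + \<tau> y" "\<tau> (x * y) = \<tau> x * \<tau> y"
      "\<tau> x = 0 \<longleftrightarrow> x = 0" for x y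
    using \<tau> by (auto simp: basis_vec_def)
  note finb = finite_support_basis_vec
  {
    case null_zero
    show ?case by (simp add: \<tau>_simps pushforward_def null_tensors.null_zero)
  next
    case (null_additive f i a b)
    let ?b = "\<lambda>a. basis_vec (f(i := a))"
    \<comment> \<open>Both choices of \<tau> fix the real values of basis vectors; the explicit
      coefficients \<open>- 1\<close> give the shape \<open>u + c * v\<close> required for
      linearity.\<close>
    have "(\<lambda>h. \<tau> (?b (a \<oplus>\<^bsub>A i\<^esub> b) h - ?b a h - ?b b h)) =
        (\<lambda>h. (?b (a \<oplus>\<^bsub>A i\<^esub> b) h + (- 1) * ?b a h) + (- 1) * ?b b h)"
      using \<tau> by (auto simp: basis_vec_def)
    then have "pushforward ?P (\<lambda>h. \<tau> (?b (a \<oplus>\<^bsub>A i\<^esub> b) h - ?b a h - ?b b h)) =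
       (\<lambda>h. basis_vec (?P (f(i := a \<oplus>\<^bsub>A i\<^esub> b))) h - basis_vec (?P (f(i := a))) h
          - basis_vec (?P (f(i := b))) h)"
      by (simp only: pushforward_lincomb finb finite_support_lincomb pushforward_basis_vec) simp
    also have "\<dots> = (\<lambda>h. basis_vec ((?P f)(i := p i a \<oplus>\<^bsub>A i\<^esub> p i b)) h
        - basis_vec ((?P f)(i := p i a)) h - basis_vec ((?P f)(i := p i b)) h)"
      using null_additive by (simp add: P_upd p_add)
    also have "\<dots> \<in> null_tensors A J"
      using null_additive \<open>I \<subseteq> J\<close>
      by (intro null_tensors.null_additive P_ktuples p_closed) auto
    finally show ?case .
  next
    case (null_homogeneous f i a c)
    let ?b = "\<lambda>a. basis_vec (f(i := a))"
    have "(\<lambda>h. \<tau> (?b (c \<odot>\<^bsub>A i\<^esub> a) h - c * ?b a h)) =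
        (\<lambda>h. ?b (c \<odot>\<^bsub>A i\<^esub> a) h + (- \<tau> c) * ?b a h)"
      using \<tau> by (auto simp: basis_vec_def)
    then have "pushforward ?P (\<lambda>h. \<tau> (?b (c \<odot>\<^bsub>A i\<^esub> a) h - c * ?b a h)) =
       (\<lambda>h. basis_vec (?P (f(i := c \<odot>\<^bsub>A i\<^esub> a))) h - \<tau> c * basis_vec (?P (f(i := a))) h)"
      by (simp only: pushforward_lincomb finb pushforward_basis_vec) simp
    also have "\<dots> = (\<lambda>h. basis_vec ((?P f)(i := \<tau> c \<odot>\<^bsub>A i\<^esub> p i a)) h
        - \<tau> c * basis_vec ((?P f)(i := p i a)) h)"
      using null_homogeneous by (simp add: P_upd p_smult)
    also have "\<dots> \<in> null_tensors A J"
      using null_homogeneous \<open>I \<subseteq> J\<close>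
      by (intro null_tensors.null_homogeneous P_ktuples p_closed) auto
    finally show ?case .
  next
    case (null_add u v)
    have "(\<lambda>h. \<tau> (u h + v h)) = (\<lambda>h. \<tau> (u h) + 1 * \<tau> (v h))"
      by (simp add: \<tau>_simps)
    moreover have "pushforward ?P (\<lambda>h. \<tau> (u h) + 1 * \<tau> (v h)) =
        (\<lambda>h. pushforward ?P (\<lambda>f. \<tau> (u f)) h + 1 * pushforward ?P (\<lambda>f. \<tau> (v f)) h)"
      using null_add(1,2) by (intro pushforward_lincomb) (simp_all add: \<tau>_simps null_support)
    ultimately show ?case using null_tensors.null_add[OF null_add(3,4)] by simp
  next
    case (null_smult u c)
    \<comment> \<open>Adding the zero function makes scaling a case of
      \<open>pushforward_lincomb\<close>.\<close>
    have "(\<lambda>h. \<tau> (c * u h)) = (\<lambda>h. 0 + \<tau> c * \<tau> (u h))"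
      by (simp add: \<tau>_simps)
    moreover have "pushforward ?P (\<lambda>h. 0 + \<tau> c * \<tau> (u h)) =
        (\<lambda>h. pushforward ?P (\<lambda>_. 0) h + \<tau> c * pushforward ?P (\<lambda>f. \<tau> (u f)) h)"
      using null_smult(1) by (intro pushforward_lincomb) (simp_all add: \<tau>_simps null_support)
    ultimately show ?case
      using null_tensors.null_smult[OF null_smult(2), of "\<tau> c"] by (simp add: pushforward_def)
  }
qed

text \<open>Right multiplication by \<open>g i\<close> is linear in each slot. With
  \<open>J = I\<close> there is no slot to fill, hence the filler \<open>undefined\<close>.\<close>

lemma pushforward_mult_right_null:
  assumes "u \<in> null_tensors A I" "g \<in> ktuples A I"
  shows "pushforward (\<lambda>f. tuple_mult A I f g) u \<in> null_tensors A I"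
proof -
  have g: "g i \<in> carrier (A i)" if "i \<in> I" for i using assms(2) that by (auto simp: ktuples_def)
  have "pushforward (slotwise I I (\<lambda>i a. a \<otimes>\<^bsub>A i\<^esub> g i) undefined) (\<lambda>f. u f) \<in> null_tensors A I"
    by (rule pushforward_null[where \<tau> = "\<lambda>z. z"])
      (use assms g in \<open>auto simp: ring.ring_simprules[OF family_ring]
        unital_star_algebra.smult_mult_left[OF family_algebra]\<close>)
  moreover have "slotwise I I (\<lambda>i a. a \<otimes>\<^bsub>A i\<^esub> g i) undefined = (\<lambda>f. tuple_mult A I f g)"
    by (auto simp: slotwise_def tuple_mult_def fun_eq_iff)
  ultimately show ?thesis by simp
qed

lemma pushforward_mult_left_null:
  assumes "u \<in> null_tensors A I" "g \<in> ktuples A I"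
  shows "pushforward (tuple_mult A I g) u \<in> null_tensors A I"
proof -
  have g: "g i \<in> carrier (A i)" if "i \<in> I" for i using assms(2) that by (auto simp: ktuples_def)
  have "pushforward (slotwise I I (\<lambda>i a. g i \<otimes>\<^bsub>A i\<^esub> a) undefined) (\<lambda>f. u f) \<in> null_tensors A I"
    by (rule pushforward_null[where \<tau> = "\<lambda>z. z"])
      (use assms g in \<open>auto simp: ring.ring_simprules[OF family_ring]
        unital_star_algebra.smult_mult_right[OF family_algebra]\<close>)
  moreover have "slotwise I I (\<lambda>i a. g i \<otimes>\<^bsub>A i\<^esub> a) undefined = tuple_mult A I g"
    by (auto simp: slotwise_def tuple_mult_def fun_eq_iff)
  ultimately show ?thesis by simp
qed

text \<open>With tuples standing for their basis vectors,
  \<open>u v - f g = (u - f) v + f (v - g)\<close>. Both terms are null, because null tensors absorb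
  multiplication on either side.\<close>

lemma free_mult_class:
  assumes f: "f \<in> ktuples A I" and g: "g \<in> ktuples A I"
    and u: "u \<in> tensor_class A I (basis_vec f)" and v: "v \<in> tensor_class A I (basis_vec g)"
  shows "mult (free_tensors A I) u v \<in> tensor_class A I (basis_vec (tuple_mult A I f g))"
proof -
  let ?m = "mult (free_tensors A I)"
  note us = tensor_class_support[OF u f] and vs = tensor_class_support[OF v g]
  note finb = finite_support_basis_vec
  \<comment> \<open>This is \<open>(u - f) v\<close>, expanded over the finite support of
    \<open>v\<close>.\<close>
  have "(\<lambda>h. \<Sum>k | v k \<noteq> 0. v k * pushforward (\<lambda>f. tuple_mult A I f k) (\<lambda>h. u h - basis_vec f h) h)
      \<in> null_tensors A I"
    using u vs by (intro null_sum pushforward_mult_right_null) (auto simp: tensor_class_eq)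
  also have "(\<lambda>h. \<Sum>k | v k \<noteq> 0. v k * pushforward (\<lambda>f. tuple_mult A I f k) (\<lambda>h. u h - basis_vec f h) h)
      = (\<lambda>h. ?m u v h - ?m (basis_vec f) v h)"
    by (simp add: free_mult_eq_left us vs finb pushforward_diff sum_subtractf right_diff_distrib)
  finally have 1: "(\<lambda>h. ?m u v h - ?m (basis_vec f) v h) \<in> null_tensors A I" .
  have "pushforward (tuple_mult A I f) (\<lambda>h. v h - basis_vec g h) \<in> null_tensors A I"
    using v f by (intro pushforward_mult_left_null) (auto simp: tensor_class_eq)
  then have 2: "(\<lambda>h. ?m (basis_vec f) v h - basis_vec (tuple_mult A I f g) h) \<in> null_tensors A I"
    by (simp add: free_mult_basis_vec_left vs finb pushforward_diff pushforward_basis_vec)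
  from null_add[OF 1 2] show ?thesis by (simp add: tensor_class_eq)
qed

section \<open>Simple tensors\<close>

lemma restrict_ktuples:
  "(\<And>i. i \<in> I \<Longrightarrow> f i \<in> carrier (A i)) \<Longrightarrow> restrict f I \<in> ktuples A I"
  by (auto simp: ktuples_def)

lemma simple_tensor_closed:
  assumes "\<And>i. i \<in> I \<Longrightarrow> f i \<in> carrier (A i)"
  shows "simple_tensor A I f \<in> carrier (tensor_algebra A I)"
proof -
  have "basis_vec (restrict f I) \<in> carrier (free_tensors A I)"
    using restrict_ktuples[of I f] assms by (auto simp: free_tensors_def basis_vec_def)
  then show ?thesis
    by (auto simp: tensor_algebra_def cstar_of_def add_nrm_def tensor_star_algebra_def Let_def
        FactRing_def A_RCOSETS_def RCOSETS_def simple_tensor_def tensor_class_def a_r_coset_def)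
qed

lemma simple_tensor_one: "simple_tensor A I (\<lambda>i. \<one>\<^bsub>A i\<^esub>) = \<one>\<^bsub>tensor_algebra A I\<^esub>"
  by (simp add: tensor_algebra_def cstar_of_def add_nrm_def tensor_star_algebra_def Let_def
      FactRing_def simple_tensor_def tensor_class_def free_tensors_def)

lemma simple_tensor_mult:
  assumes f: "\<And>i. i \<in> I \<Longrightarrow> f i \<in> carrier (A i)" and g: "\<And>i. i \<in> I \<Longrightarrow> g i \<in> carrier (A i)"
  shows "simple_tensor A I f \<otimes>\<^bsub>tensor_algebra A I\<^esub> simple_tensor A I g =
    simple_tensor A I (\<lambda>i. f i \<otimes>\<^bsub>A i\<^esub> g i)"
proof -
  let ?f = "restrict f I" and ?g = "restrict g I"
  have fg: "?f \<in> ktuples A I" "?g \<in> ktuples A I" using f g restrict_ktuples by blast+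
  have "simple_tensor A I f \<otimes>\<^bsub>tensor_algebra A I\<^esub> simple_tensor A I g =
     (\<Union>u\<in>tensor_class A I (basis_vec ?f). \<Union>v\<in>tensor_class A I (basis_vec ?g).
        tensor_class A I (mult (free_tensors A I) u v))"
    by (simp add: tensor_algebra_def cstar_of_def add_nrm_def tensor_star_algebra_def Let_def
        FactRing_def simple_tensor_def rcoset_mult_def tensor_class_def)
  \<comment> \<open>For each fixed \<open>u\<close> the inner union is a single class, the same for
    all \<open>u\<close>; the outer union over a nonempty class is then constant.\<close>
  also have "\<dots> = (\<Union>u\<in>tensor_class A I (basis_vec ?f).
      tensor_class A I (basis_vec (tuple_mult A I ?f ?g)))"
    using free_mult_class[OF fg] by (intro SUP_cong refl union_tensor_classes)
  also have "\<dots> = tensor_class A I (basis_vec (tuple_mult A I ?f ?g))"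
    using tensor_class_self by blast
  also have "tuple_mult A I ?f ?g = (\<lambda>i\<in>I. f i \<otimes>\<^bsub>A i\<^esub> g i)"
    by (auto simp: tuple_mult_def)
  finally show ?thesis by (simp only: simple_tensor_def)
qed

lemma simple_tensor_adj:
  assumes f: "\<And>i. i \<in> I \<Longrightarrow> f i \<in> carrier (A i)"
  shows "adj (tensor_algebra A I) (simple_tensor A I f) = simple_tensor A I (\<lambda>i. adj (A i) (f i))"
proof -
  let ?f = "restrict f I" and ?P = "\<lambda>f. \<lambda>i\<in>I. adj (A i) (f i)"
  have "?f \<in> ktuples A I" using f restrict_ktuples by blast
  have fs: "?P ?f = (\<lambda>i\<in>I. adj (A i) (f i))" by auto
  have P: "?P = slotwise I I (\<lambda>i. adj (A i)) undefined" by (auto simp: slotwise_def fun_eq_iff)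
  have "adj (free_tensors A I) v \<in> tensor_class A I (basis_vec (?P ?f))"
    if v: "v \<in> tensor_class A I (basis_vec ?f)" for v
  proof -
    have "pushforward (slotwise I I (\<lambda>i. adj (A i)) undefined) (\<lambda>h. cnj (v h - basis_vec ?f h))
        \<in> null_tensors A I"
      by (rule pushforward_null[where \<tau> = cnj and u = "\<lambda>h. v h - basis_vec ?f h"])
        (use v in \<open>auto simp: tensor_class_eq unital_star_algebra.adj_closed[OF family_algebra]
          unital_star_algebra.adj_add[OF family_algebra]
          unital_star_algebra.adj_smult[OF family_algebra]\<close>)
    \<comment> \<open>Basis vectors are real-valued, so conjugation touches only
      \<open>v\<close>.\<close>
    moreover have "(\<lambda>h. cnj (v h - basis_vec ?f h)) = (\<lambda>h. cnj (v h) - basis_vec ?f h)"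
      by (auto simp: basis_vec_def)
    moreover have "pushforward ?P (\<lambda>h. cnj (v h) - basis_vec ?f h) =
        (\<lambda>h. pushforward ?P (\<lambda>h. cnj (v h)) h - basis_vec (?P ?f) h)"
      using tensor_class_support(1)[OF v \<open>?f \<in> ktuples A I\<close>]
      by (subst pushforward_diff) (simp_all only: finite_support_basis_vec pushforward_basis_vec
          complex_cnj_zero_iff)
    ultimately have "(\<lambda>h. pushforward ?P (\<lambda>h. cnj (v h)) h - basis_vec (?P ?f) h) \<in> null_tensors A I"
      by (simp only: P)
    then show ?thesis by (simp add: tensor_class_eq free_tensors_def)
  qed
  then have "(\<Union>v\<in>tensor_class A I (basis_vec ?f). tensor_class A I (adj (free_tensors A I) v)) =
      tensor_class A I (basis_vec (?P ?f))"
    by (rule union_tensor_classes)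
  then show ?thesis
    unfolding fs by (simp add: tensor_algebra_def cstar_of_def add_nrm_def tensor_star_algebra_def
        Let_def simple_tensor_def)
qed

text \<open>A scalar may be absorbed into any one slot: for a representative \<open>v\<close>, the
  difference to the new basis vector is \<open>c (v - f)\<close> minus a homogeneity relation in
  slot \<open>i\<close>.\<close>

lemma simple_tensor_smult:
  assumes f: "\<And>i. i \<in> I \<Longrightarrow> f i \<in> carrier (A i)" and i: "i \<in> I"
  shows "c \<odot>\<^bsub>tensor_algebra A I\<^esub> simple_tensor A I f = simple_tensor A I (f(i := c \<odot>\<^bsub>A i\<^esub> f i))"
proof -
  let ?f = "restrict f I"
  have k: "?f \<in> ktuples A I" using f restrict_ktuples by blast
  have fs: "restrict (f(i := c \<odot>\<^bsub>A i\<^esub> f i)) I = ?f(i := c \<odot>\<^bsub>A i\<^esub> f i)" "?f(i := f i) = ?f"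
    using i by (auto simp: fun_eq_iff)
  have "c \<odot>\<^bsub>free_tensors A I\<^esub> v \<in> tensor_class A I (basis_vec (?f(i := c \<odot>\<^bsub>A i\<^esub> f i)))"
    if v: "v \<in> tensor_class A I (basis_vec ?f)" for v
  proof -
    have 1: "(\<lambda>h. c * (v h - basis_vec ?f h)) \<in> null_tensors A I"
      using v by (intro null_smult) (simp add: tensor_class_eq)
    have 2: "(\<lambda>h. basis_vec (?f(i := c \<odot>\<^bsub>A i\<^esub> f i)) h - c * basis_vec ?f h) \<in> null_tensors A I"
      using null_homogeneous[OF k i f[OF i], of c] unfolding fs .
    from null_diff[OF 1 2] show ?thesis
      by (simp add: tensor_class_eq free_tensors_def right_diff_distrib)
  qed
  then have "(\<Union>v\<in>tensor_class A I (basis_vec ?f). tensor_class A I (c \<odot>\<^bsub>free_tensors A I\<^esub> v)) =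
      tensor_class A I (basis_vec (?f(i := c \<odot>\<^bsub>A i\<^esub> f i)))"
    by (rule union_tensor_classes)
  then show ?thesis
    by (simp add: tensor_algebra_def cstar_of_def add_nrm_def tensor_star_algebra_def
        Let_def simple_tensor_def fs del: fun_upd_apply)
qed

lemma insert_units_simple_tensor:
  assumes f: "\<And>i. i \<in> I \<Longrightarrow> f i \<in> carrier (A i)" and "I \<subseteq> J"
  shows "insert_units A J I (simple_tensor A I f) =
    simple_tensor A J (\<lambda>j. if j \<in> I then f j else \<one>\<^bsub>A j\<^esub>)"
proof -
  let ?f = "restrict f I" and ?P = "\<lambda>f. \<lambda>j\<in>J. if j \<in> I then f j else \<one>\<^bsub>A j\<^esub>"
  have "?f \<in> ktuples A I" using f restrict_ktuples by blast
  have fs: "?P ?f = (\<lambda>j\<in>J. if j \<in> I then f j else \<one>\<^bsub>A j\<^esub>)" by auto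
  have P: "?P = slotwise I J (\<lambda>_ a. a) (\<lambda>j. \<one>\<^bsub>A j\<^esub>)" by (auto simp: slotwise_def fun_eq_iff)
  have "pushforward ?P v \<in> tensor_class A J (basis_vec (?P ?f))"
    if v: "v \<in> tensor_class A I (basis_vec ?f)" for v
  proof -
    have "pushforward (slotwise I J (\<lambda>_ a. a) (\<lambda>j. \<one>\<^bsub>A j\<^esub>)) (\<lambda>h. v h - basis_vec ?f h)
        \<in> null_tensors A J"
      by (rule pushforward_null[where \<tau> = "\<lambda>z. z" and u = "\<lambda>h. v h - basis_vec ?f h"])
        (use v \<open>I \<subseteq> J\<close> in \<open>auto simp: tensor_class_eq ring.ring_simprules(6)[OF family_ring]\<close>)
    moreover have "pushforward ?P (\<lambda>h. v h - basis_vec ?f h) =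
        (\<lambda>h. pushforward ?P v h - basis_vec (?P ?f) h)"
      using tensor_class_support(1)[OF v \<open>?f \<in> ktuples A I\<close>]
      by (subst pushforward_diff) (simp_all only: finite_support_basis_vec pushforward_basis_vec)
    ultimately have "(\<lambda>h. pushforward ?P v h - basis_vec (?P ?f) h) \<in> null_tensors A J"
      by (simp only: P)
    then show ?thesis by (simp add: tensor_class_eq)
  qed
  then have "(\<Union>v\<in>tensor_class A I (basis_vec ?f). tensor_class A J (pushforward ?P v)) =
      tensor_class A J (basis_vec (?P ?f))"
    by (rule union_tensor_classes)
  then show ?thesis unfolding fs by (simp add: insert_units_def simple_tensor_def)
qed

end

section \<open>Fermions from spins in a *-algebra\<close>

context unital_star_algebra
begin

text \<open>In this context the unqualified library names (\<open>m_assoc\<close>, \<open>l_distr\<close>, \<open>a_ac\<close>) can resolve to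
  the scalar ring of the module rather than to \<open>M\<close>.\<close>

lemma ring_M: "ring M"
  by unfold_locales

lemmas alg_assoc = ring.ring_simprules(11)[OF ring_M]
lemmas alg_distr = ring.ring_simprules(13,23)[OF ring_M]
lemmas alg_add_ac = ring.ring_simprules(7,10,22)[OF ring_M]

text \<open>The scalars form the record \<open>cring_class_ops\<close>; this lemma and the next ones
  restate the module laws in ordinary complex arithmetic.\<close>

lemma scalar_closed: "x \<in> carrier M \<Longrightarrow> (c :: complex) \<odot> x \<in> carrier M"
  by (simp add: smult_closed carrier_class)

lemma scalar_add_left: "x \<in> carrier M \<Longrightarrow> (c + d) \<odot> x = c \<odot> x \<oplus> d \<odot> x"
  using smult_l_distr[of c d x] by (simp add: carrier_class plus_class)

lemma scalar_add_right:
  "\<lbrakk>x \<in> carrier M; y \<in> carrier M\<rbrakk> \<Longrightarrow> (c :: complex) \<odot> (x \<oplus> y) = c \<odot> x \<oplus> c \<odot> y"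
  using smult_r_distr[of c x y] by (simp add: carrier_class)

lemma scalar_scalar: "x \<in> carrier M \<Longrightarrow> c \<odot> (d \<odot> x) = (c * d) \<odot> x"
  using smult_assoc1[of c d x] by (simp add: carrier_class times_class)

lemma scalar_one: "x \<in> carrier M \<Longrightarrow> 1 \<odot> x = x"
  using smult_one[of x] by (simp add: one_class)

lemma scalar_zero: "x \<in> carrier M \<Longrightarrow> 0 \<odot> x = \<zero>"
  using smult_l_null[of x] by (simp add: zero_class)

lemma scalar_minus: "x \<in> carrier M \<Longrightarrow> (- 1) \<odot> x = \<ominus> x"
  using smult_l_minus[of 1 x] by (simp add: carrier_class uminus_class scalar_one)

lemma scalar_minus_cancel: "x \<in> carrier M \<Longrightarrow> c \<odot> x \<oplus> (- c) \<odot> x = \<zero>"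
  using scalar_add_left[of x c "- c"] by (simp add: scalar_zero)

text \<open>The adjoint of \<open>adj M \<one> \<otimes> \<one>\<close> is evaluated twice: by the
  unit law with involutivity, and by reversing the product.\<close>

lemma adj_one: "adj M \<one> = \<one>"
proof -
  have "\<one> = adj M (adj M \<one> \<otimes> \<one>)" by (simp add: adj_closed adj_adj)
  also have "\<dots> = adj M \<one>" by (subst adj_mult) (simp_all add: adj_closed adj_adj)
  finally show ?thesis by simp
qed

section \<open>Commutation up to a scalar\<close>

definition scommute :: "complex \<Rightarrow> 'a \<Rightarrow> 'a \<Rightarrow> bool" where
  "scommute \<epsilon> a b \<longleftrightarrow> a \<otimes> b = \<epsilon> \<odot> (b \<otimes> a)"

lemma scommute_one_right: "a \<in> carrier M \<Longrightarrow> scommute 1 a \<one>"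
  by (simp add: scommute_def scalar_one)

lemma scommute_sym:
  assumes "scommute \<epsilon> a b" "\<epsilon> * \<epsilon> = 1" "a \<in> carrier M" "b \<in> carrier M"
  shows "scommute \<epsilon> b a"
  using assms by (simp add: scommute_def scalar_scalar scalar_one)

text \<open>Moving \<open>a\<close> past \<open>b\<close> and then past \<open>c\<close> collects
  one factor each time, so signs multiply along a product.\<close>

lemma scommute_mult_right:
  assumes "scommute \<epsilon> a b" "scommute \<delta> a c"
    and [simp]: "a \<in> carrier M" "b \<in> carrier M" "c \<in> carrier M"
  shows "scommute (\<epsilon> * \<delta>) a (b \<otimes> c)"
proof -
  have "a \<otimes> (b \<otimes> c) = (a \<otimes> b) \<otimes> c" by (simp add: alg_assoc)
  also have "\<dots> = \<epsilon> \<odot> (b \<otimes> (a \<otimes> c))"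
    using assms(1) by (simp add: scommute_def smult_mult_left alg_assoc)
  also have "\<dots> = \<epsilon> \<odot> (\<delta> \<odot> (b \<otimes> (c \<otimes> a)))"
    using assms(2) by (simp add: scommute_def smult_mult_right)
  finally show ?thesis by (simp add: scommute_def scalar_scalar alg_assoc)
qed

lemma scommute_mult_left:
  assumes "scommute \<epsilon> a c" "scommute \<delta> b c"
    and [simp]: "a \<in> carrier M" "b \<in> carrier M" "c \<in> carrier M"
  shows "scommute (\<epsilon> * \<delta>) (a \<otimes> b) c"
proof -
  have "(a \<otimes> b) \<otimes> c = a \<otimes> (b \<otimes> c)" by (simp add: alg_assoc)
  also have "\<dots> = \<delta> \<odot> ((a \<otimes> c) \<otimes> b)"
    using assms(2) by (simp add: scommute_def smult_mult_right alg_assoc)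
  also have "\<dots> = \<delta> \<odot> (\<epsilon> \<odot> (c \<otimes> (a \<otimes> b)))"
    using assms(1) by (simp add: scommute_def smult_mult_left alg_assoc)
  finally show ?thesis by (simp add: scommute_def scalar_scalar mult.commute)
qed

lemma scommute_add_right:
  assumes "scommute \<epsilon> a b" "scommute \<epsilon> a c"
    and "a \<in> carrier M" "b \<in> carrier M" "c \<in> carrier M"
  shows "scommute \<epsilon> a (b \<oplus> c)"
  using assms by (simp add: scommute_def alg_distr scalar_add_right)

lemma scommute_smult_right:
  assumes "scommute \<epsilon> a b" "a \<in> carrier M" "b \<in> carrier M"
  shows "scommute \<epsilon> a (c \<odot> b)"
  using assms
  by (simp add: scommute_def smult_mult_left smult_mult_right scalar_scalar mult.commute)

end

section \<open>Strings and ladder elements of an abstract spin system\<close>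

text \<open>The Pauli relations, isolated from the tensor construction. Self-adjointness and squares
  can be stated for every index because \<open>pauli\<close> is the identity matrix outside 1, 2,
  3.\<close>

locale spin_system = unital_star_algebra M for M :: "('a, 'm) star_alg_scheme" (structure) +
  fixes s :: "nat \<Rightarrow> int \<Rightarrow> 'a"
  assumes spin_closed: "s \<kappa> x \<in> carrier M"
    and spin_adj: "adj M (s \<kappa> x) = s \<kappa> x"
    and spin_square: "s \<kappa> x \<otimes> s \<kappa> x = \<one>"
    and spin_anticommute:
      "\<lbrakk>\<kappa> \<in> {1, 2, 3}; \<mu> \<in> {1, 2, 3}; \<kappa> \<noteq> \<mu>\<rbrakk> \<Longrightarrow> s \<kappa> x \<otimes> s \<mu> x = (- 1) \<odot> (s \<mu> x \<otimes> s \<kappa> x)"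
    and spin_commute: "x \<noteq> y \<Longrightarrow> s \<kappa> x \<otimes> s \<mu> y = s \<mu> y \<otimes> s \<kappa> x"
begin

definition ladder :: "complex \<Rightarrow> int \<Rightarrow> 'a" where
  "ladder c x = (1/2) \<odot> (s 1 x \<oplus> c \<odot> s 2 x)"

text \<open>The empty interval \<open>[1..0]\<close> covers the exceptional value \<open>S\<^sub>1 = 1\<close>.\<close>

definition string_sites :: "int \<Rightarrow> int list" where
  "string_sites x = (if x \<ge> 1 then [1..x - 1] else [x..0])"

definition string_sign :: "int \<Rightarrow> complex" where
  "string_sign x = (if x \<ge> 1 then 1 else - 1)"

definition string :: "int list \<Rightarrow> 'a" where
  "string xs = list_prod M (map (s 3) xs)"

definition fermion :: "complex \<Rightarrow> int \<Rightarrow> 'a" where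
  "fermion c x = string (string_sites x) \<otimes> ladder c x"

lemma ladder_closed [simp]: "ladder c x \<in> carrier M"
  by (simp add: ladder_def scalar_closed spin_closed)

lemma string_Nil: "string [] = \<one>"
  and string_Cons: "string (x # xs) = s 3 x \<otimes> string xs"
  by (simp_all add: string_def list_prod_def)

lemma string_closed [simp]: "string xs \<in> carrier M"
  by (induction xs) (simp_all add: string_Nil string_Cons spin_closed)

lemma fermion_closed [simp]: "fermion c x \<in> carrier M"
  by (simp add: fermion_def)

lemma string_sign_square: "string_sign x * string_sign x = 1"
  by (simp add: string_sign_def)

text \<open>Distinctness lets the site \<open>x\<close> occur at most once, so at most one factor of
  the string contributes a sign.\<close>

lemma scommute_string:
  assumes "a \<in> carrier M" "distinct xs" "scommute (- 1) a (s 3 x)"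
    and "\<And>y. y \<noteq> x \<Longrightarrow> scommute 1 a (s 3 y)"
  shows "scommute (if x \<in> set xs then - 1 else 1) a (string xs)"
  using assms(2)
proof (induction xs)
  case Nil
  show ?case using assms(1) by (simp add: string_Nil scommute_one_right)
next
  case (Cons y ys)
  have "scommute (if x = y then - 1 else 1) a (s 3 y)" using assms by auto
  with Cons have "scommute ((if x = y then - 1 else 1) * (if x \<in> set ys then - 1 else 1)) a (string (y # ys))"
    unfolding string_Cons using assms(1) by (intro scommute_mult_right) (auto simp: spin_closed)
  with Cons show ?case by (auto split: if_splits)
qed

lemma scommute_string_all:
  assumes "a \<in> carrier M" "\<And>y. scommute 1 a (s 3 y)"
  shows "scommute 1 a (string xs)"
proof (induction xs)
  case Nil
  show ?case using assms(1) by (simp add: string_Nil scommute_one_right)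
next
  case (Cons y ys)
  have "scommute (1 * 1) a (string (y # ys))"
    unfolding string_Cons using assms Cons by (intro scommute_mult_right) (auto simp: spin_closed)
  then show ?case by simp
qed

lemma spin3_commute: "scommute 1 (s 3 x) (s 3 y)"
  using spin_commute[of x y 3 3] by (cases "x = y") (auto simp: scommute_def scalar_one spin_closed)

lemma spin3_string_commute: "scommute 1 (s 3 x) (string xs)"
  using scommute_string_all spin3_commute spin_closed by blast

lemma string_commute: "scommute 1 (string xs) (string ys)"
  by (intro scommute_string_all string_closed scommute_sym[OF spin3_string_commute])
    (auto simp: spin_closed)

lemma string_square: "string xs \<otimes> string xs = \<one>"
proof (induction xs)
  case Nil
  show ?case by (simp add: string_Nil)
next
  case (Cons x xs)
  have c: "string xs \<otimes> s 3 x = s 3 x \<otimes> string xs"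
    using spin3_string_commute[of x xs] by (simp add: scommute_def scalar_one spin_closed)
  have "string (x # xs) \<otimes> string (x # xs) = s 3 x \<otimes> (string xs \<otimes> s 3 x) \<otimes> string xs"
    by (simp add: string_Cons alg_assoc spin_closed)
  also have "\<dots> = (s 3 x \<otimes> s 3 x) \<otimes> (string xs \<otimes> string xs)"
    unfolding c by (simp add: alg_assoc spin_closed)
  finally show ?case by (simp add: spin_square Cons.IH)
qed

text \<open>The adjoint reverses the order of self-adjoint factors, and their commutation restores
  it.\<close>

lemma string_adj: "adj M (string xs) = string xs"
proof (induction xs)
  case Nil
  show ?case by (simp add: string_Nil adj_one)
next
  case (Cons x xs)
  then show ?case
    using spin3_string_commute[of x xs]
    by (simp add: string_Cons adj_mult spin_closed spin_adj scommute_def scalar_one)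
qed

lemma ladder_anticommute_spin3: "scommute (- 1) (ladder c x) (s 3 x)"
proof (rule scommute_sym)
  show "scommute (- 1) (s 3 x) (ladder c x)"
    unfolding ladder_def
    by (intro scommute_smult_right scommute_add_right)
      (auto simp: scommute_def spin_closed scalar_closed intro: spin_anticommute)
qed (auto simp: spin_closed)

lemma spin_commute_ladder: "x \<noteq> y \<Longrightarrow> scommute 1 (s \<kappa> y) (ladder c x)"
  unfolding ladder_def
  by (intro scommute_smult_right scommute_add_right)
    (auto simp: scommute_def spin_closed scalar_closed scalar_one spin_commute)

lemma ladder_commute_spin: "x \<noteq> y \<Longrightarrow> scommute 1 (ladder c x) (s \<kappa> y)"
  by (rule scommute_sym[OF spin_commute_ladder]) (auto simp: spin_closed)

lemma ladder_commute: "x \<noteq> y \<Longrightarrow> scommute 1 (ladder c x) (ladder d y)"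
  unfolding ladder_def[of d y]
  by (intro scommute_smult_right scommute_add_right ladder_commute_spin)
    (auto simp: spin_closed scalar_closed)

lemma ladder_adj: "adj M (ladder c x) = ladder (cnj c) x"
  by (simp add: ladder_def adj_smult adj_add spin_adj spin_closed scalar_closed)

text \<open>Since \<open>s 2 x\<close> and \<open>s 1 x\<close> anticommute, the mixed terms combine
  to \<open>(d - c)\<close> times their product, while the squares give \<open>1 + c d\<close>; the
  two halves give the factor 1/4.\<close>

lemma ladder_mult:
  "ladder c x \<otimes> ladder d x =
    ((1 + c * d) / 4) \<odot> \<one> \<oplus> ((d - c) / 4) \<odot> (s 1 x \<otimes> s 2 x)"
proof -
  let ?a = "s 1 x" and ?b = "s 2 x"
  have 21: "?b \<otimes> ?a = (- 1) \<odot> (?a \<otimes> ?b)" by (rule spin_anticommute) auto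
  have "(?a \<oplus> c \<odot> ?b) \<otimes> (?a \<oplus> d \<odot> ?b) =
      (?a \<otimes> ?a \<oplus> c \<odot> (?b \<otimes> ?a)) \<oplus> (d \<odot> (?a \<otimes> ?b) \<oplus> (c * d) \<odot> (?b \<otimes> ?b))"
    by (simp add: alg_distr spin_closed scalar_closed smult_mult_left smult_mult_right
        scalar_scalar scalar_add_right mult.commute)
  also have "\<dots> = (\<one> \<oplus> (- c) \<odot> (?a \<otimes> ?b)) \<oplus> (d \<odot> (?a \<otimes> ?b) \<oplus> (c * d) \<odot> \<one>)"
    by (simp add: 21 spin_square spin_closed scalar_scalar del: One_nat_def)
  also have "\<dots> = (\<one> \<oplus> (c * d) \<odot> \<one>) \<oplus> (d \<odot> (?a \<otimes> ?b) \<oplus> (- c) \<odot> (?a \<otimes> ?b))"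
    by (simp add: alg_add_ac spin_closed scalar_closed)
  also have "\<dots> = (1 + c * d) \<odot> \<one> \<oplus> (d - c) \<odot> (?a \<otimes> ?b)"
    using scalar_add_left[of "?a \<otimes> ?b" d "- c"] scalar_add_left[of \<one> 1 "c * d"]
    by (simp add: spin_closed scalar_one)
  finally have e: "(?a \<oplus> c \<odot> ?b) \<otimes> (?a \<oplus> d \<odot> ?b) = (1 + c * d) \<odot> \<one> \<oplus> (d - c) \<odot> (?a \<otimes> ?b)" .
  have "ladder c x \<otimes> ladder d x = (1/4) \<odot> ((?a \<oplus> c \<odot> ?b) \<otimes> (?a \<oplus> d \<odot> ?b))"
    by (simp add: ladder_def spin_closed scalar_closed smult_mult_left smult_mult_right scalar_scalar)
  then show ?thesis
    unfolding e by (simp add: scalar_add_right spin_closed scalar_closed scalar_scalar)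
qed

text \<open>The mixed term of \<open>ladder_mult\<close> is antisymmetric in \<open>c\<close> and
  \<open>d\<close> and cancels; the scalar term is symmetric and doubles.\<close>

lemma ladder_anticommutator:
  "ladder c x \<otimes> ladder d x \<oplus> ladder d x \<otimes> ladder c x = ((1 + c * d) / 2) \<odot> \<one>"
proof -
  let ?u = "((1 + c * d) / 4) \<odot> \<one>" and ?v = "s 1 x \<otimes> s 2 x"
  have v: "?v \<in> carrier M" by (simp add: spin_closed)
  have "ladder c x \<otimes> ladder d x \<oplus> ladder d x \<otimes> ladder c x =
      (?u \<oplus> ((d - c) / 4) \<odot> ?v) \<oplus> (?u \<oplus> ((c - d) / 4) \<odot> ?v)"
    by (simp add: ladder_mult mult.commute)
  also have "\<dots> = (?u \<oplus> ?u) \<oplus> (((d - c) / 4) \<odot> ?v \<oplus> ((c - d) / 4) \<odot> ?v)"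
    by (simp add: alg_add_ac spin_closed scalar_closed)
  also have "?u \<oplus> ?u = ((1 + c * d) / 2) \<odot> \<one>"
    using scalar_add_left[of \<one> "(1 + c * d) / 4" "(1 + c * d) / 4"] by simp
  also have "((d - c) / 4) \<odot> ?v \<oplus> ((c - d) / 4) \<odot> ?v = \<zero>"
    using scalar_minus_cancel[OF v, of "(d - c) / 4"] by (simp add: minus_divide_left)
  finally show ?thesis by (simp add: scalar_closed)
qed

section \<open>Signs from moving ladder elements through strings\<close>

definition hop_sign :: "int \<Rightarrow> int \<Rightarrow> complex" where
  "hop_sign x y = (if y \<in> set (string_sites x) then - 1 else 1)"

lemma string_ladder:
  "scommute (hop_sign x y) (ladder c y) (string (string_sites x))"
  unfolding hop_sign_def
  by (intro scommute_string ladder_anticommute_spin3 ladder_commute_spin)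
    (auto simp: string_sites_def)

lemma ladder_string:
  "scommute (hop_sign x y) (string (string_sites x)) (ladder c y)"
  by (rule scommute_sym[OF string_ladder]) (auto simp: hop_sign_def)

text \<open>A string contains its own site exactly when \<open>x \<le> 0\<close>: the list
  \<open>[x..0]\<close> starts at \<open>x\<close>, whereas \<open>[1..x - 1]\<close> stops just
  before it.\<close>

lemma hop_sign_self: "hop_sign x x = string_sign x"
  by (auto simp: hop_sign_def string_sites_def string_sign_def)

text \<open>If both sites lie on the same side of the cut between 0 and 1, exactly one string covers
  the other site. On opposite sides neither does.\<close>

lemma hop_sign_mult: "x \<noteq> y \<Longrightarrow> hop_sign x y * hop_sign y x = - (string_sign x * string_sign y)"
  by (auto simp: hop_sign_def string_sites_def string_sign_def)

text \<open>Strings commute with strings, and ladder elements at different sites commute. Only the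
  two crossings of a ladder element with the other string produce signs.\<close>

lemma fermion_scommute:
  assumes "x \<noteq> y"
  shows "scommute (- (string_sign x * string_sign y)) (fermion c x) (fermion d y)"
proof -
  let ?S = "\<lambda>x. string (string_sites x)"
  have "scommute (1 * hop_sign x y) (?S x) (fermion d y)"
    unfolding fermion_def by (intro scommute_mult_right string_commute ladder_string) auto
  moreover have "scommute (hop_sign y x * 1) (ladder c x) (fermion d y)"
    unfolding fermion_def using assms
    by (intro scommute_mult_right ladder_commute string_ladder) auto
  ultimately have "scommute ((1 * hop_sign x y) * (hop_sign y x * 1)) (fermion c x) (fermion d y)"
    unfolding fermion_def[of c x] by (intro scommute_mult_left) auto
  with hop_sign_mult[OF assms] show ?thesis by simp
qed

lemma fermion_mult_self:
  "fermion c x \<otimes> fermion d x = string_sign x \<odot> (ladder c x \<otimes> ladder d x)"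
proof -
  let ?S = "string (string_sites x)"
  have "fermion c x \<otimes> fermion d x = ?S \<otimes> (ladder c x \<otimes> ?S) \<otimes> ladder d x"
    by (simp add: fermion_def alg_assoc)
  also have "ladder c x \<otimes> ?S = string_sign x \<odot> (?S \<otimes> ladder c x)"
    using string_ladder[of x x c] by (simp add: scommute_def hop_sign_self)
  also have "?S \<otimes> (string_sign x \<odot> (?S \<otimes> ladder c x)) \<otimes> ladder d x =
      string_sign x \<odot> ((?S \<otimes> ?S) \<otimes> (ladder c x \<otimes> ladder d x))"
    by (simp add: smult_mult_left smult_mult_right alg_assoc)
  finally show ?thesis by (simp add: string_square)
qed

text \<open>This is the upper left entry of the matrix anticommutator. At equal sites the sign from
  \<open>fermion_mult_self\<close> is squared away by the sign of the matrix entry.\<close>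

lemma fermion_anticommutator:
  "(string_sign x \<odot> fermion c x) \<otimes> fermion d y \<oplus> (string_sign y \<odot> fermion d y) \<otimes> fermion c x =
    (if x = y then (1 + c * d) / 2 else 0) \<odot> \<one>"
proof (cases "x = y")
  case True
  then show ?thesis
    by (simp add: smult_mult_left fermion_mult_self scalar_scalar string_sign_square scalar_one
        ladder_anticommutator)
next
  case False
  let ?e = "string_sign x" and ?f = "string_sign y"
  have "(?e \<odot> fermion c x) \<otimes> fermion d y = ?e \<odot> ((- (?e * ?f)) \<odot> (fermion d y \<otimes> fermion c x))"
    using fermion_scommute[OF False, of c d] by (simp add: smult_mult_left scommute_def)
  \<comment> \<open>The square of \<open>?e\<close> is 1, which leaves the exact opposite of the
    second summand.\<close>
  also have "\<dots> = (- ?f) \<odot> (fermion d y \<otimes> fermion c x)"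
    by (simp add: scalar_scalar string_sign_def)
  finally show ?thesis
    using False scalar_minus_cancel[of "fermion d y \<otimes> fermion c x" "- ?f"]
    by (simp add: smult_mult_left scalar_zero)
qed

text \<open>The lower right entry equals the upper left one multiplied by both signs. This changes
  nothing: the signs multiply to 1 if \<open>x = y\<close>, and otherwise the value is zero.\<close>

lemma fermion_anticommutator':
  "fermion c x \<otimes> (string_sign y \<odot> fermion d y) \<oplus> fermion d y \<otimes> (string_sign x \<odot> fermion c x) =
    (if x = y then (1 + c * d) / 2 else 0) \<odot> \<one>"
proof -
  let ?e = "string_sign x" and ?f = "string_sign y" and ?p = "fermion c x" and ?q = "fermion d y"
  have "?p \<otimes> (?f \<odot> ?q) \<oplus> ?q \<otimes> (?e \<odot> ?p) = (?e * ?f) \<odot> ((?e \<odot> ?p) \<otimes> ?q \<oplus> (?f \<odot> ?q) \<otimes> ?p)"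
    by (simp add: smult_mult_left smult_mult_right scalar_add_right scalar_closed scalar_scalar)
      (simp add: string_sign_def)
  also have "\<dots> = (if x = y then (1 + c * d) / 2 else 0) \<odot> \<one>"
    unfolding fermion_anticommutator by (simp add: scalar_scalar string_sign_square)
  finally show ?thesis .
qed

text \<open>The adjoint puts the ladder element in front; moving it back through its own string
  costs \<open>string_sign x\<close>.\<close>

lemma fermion_adj: "adj M (fermion c x) = string_sign x \<odot> fermion (cnj c) x"
proof -
  have "adj M (fermion c x) = ladder (cnj c) x \<otimes> string (string_sites x)"
    by (simp add: fermion_def adj_mult string_adj ladder_adj)
  then show ?thesis
    using string_ladder[of x x "cnj c"] by (simp add: scommute_def hop_sign_self fermion_def)
qed

end

section \<open>The spin algebra and its extension\<close>

lemma mat2_nth [simp]: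
  "mat2 a b c d $ 1 $ 1 = a" "mat2 a b c d $ 1 $ 2 = b"
  "mat2 a b c d $ 2 $ 1 = c" "mat2 a b c d $ 2 $ 2 = d"
  by (simp_all add: mat2_def)

lemma pauli_square: "pauli \<kappa> ** pauli \<kappa> = mat 1"
  by (simp add: pauli_def vec_eq_iff forall_2 matrix_matrix_mult_def sum_2 mat_def)

lemma pauli_anticommute:
  "\<lbrakk>\<kappa> \<in> {1, 2, 3}; \<mu> \<in> {1, 2, 3}; \<kappa> \<noteq> \<mu>\<rbrakk>
    \<Longrightarrow> pauli \<kappa> ** pauli \<mu> = (\<chi> i j. (- 1) * (pauli \<mu> ** pauli \<kappa>) $ i $ j)"
  by (auto simp: pauli_def vec_eq_iff forall_2 matrix_matrix_mult_def sum_2)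

lemma pauli_adj: "(\<chi> i j. cnj (pauli \<kappa> $ j $ i)) = pauli \<kappa>"
  by (simp add: pauli_def vec_eq_iff forall_2 mat_def)

section \<open>Site algebras inside the spin algebra\<close>

context spin_algebra
begin

sublocale site_algebras: algebra_family A
  by (intro algebra_family.intro unital_cstar_algebra.axioms(1) site_algebra)

sublocale unital_star_algebra AA
  by (rule unital_cstar_algebra.axioms(1)[OF spin_cstar])

lemma local_hom:
  assumes "\<Lambda> \<in> Fin_Z"
  shows "X \<in> carrier (tensor_algebra A \<Lambda>) \<Longrightarrow> \<phi> \<Lambda> X \<in> carrier AA"
    and "\<lbrakk>X \<in> carrier (tensor_algebra A \<Lambda>); Y \<in> carrier (tensor_algebra A \<Lambda>)\<rbrakk>
      \<Longrightarrow> \<phi> \<Lambda> (X \<otimes>\<^bsub>tensor_algebra A \<Lambda>\<^esub> Y) = \<phi> \<Lambda> X \<otimes>\<^bsub>AA\<^esub> \<phi> \<Lambda> Y"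
    and "\<phi> \<Lambda> \<one>\<^bsub>tensor_algebra A \<Lambda>\<^esub> = \<one>\<^bsub>AA\<^esub>"
    and "X \<in> carrier (tensor_algebra A \<Lambda>)
      \<Longrightarrow> \<phi> \<Lambda> (c \<odot>\<^bsub>tensor_algebra A \<Lambda>\<^esub> X) = c \<odot>\<^bsub>AA\<^esub> \<phi> \<Lambda> X"
    and "X \<in> carrier (tensor_algebra A \<Lambda>)
      \<Longrightarrow> \<phi> \<Lambda> (adj (tensor_algebra A \<Lambda>) X) = adj AA (\<phi> \<Lambda> X)"
  using local_iso[OF assms] local_subalgebra[OF assms]
  by (auto simp: star_iso_def star_hom_def ring_hom_def unital_cstar_subalgebra_def)

text \<open>Extends the construction of \<open>spin\<close> from Pauli elements to the whole site
  algebra, so that products and adjoints can be transported.\<close>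

definition embed :: "int \<Rightarrow> 'b \<Rightarrow> 'a" where
  "embed x a = \<phi> {x} (simple_tensor A {x} (\<lambda>_. a))"

lemma singleton_Fin_Z: "{x} \<in> Fin_Z"
  by (simp add: Fin_Z_def)

lemma site_tensor_closed:
  "a \<in> carrier (A x) \<Longrightarrow> simple_tensor A {x} (\<lambda>_. a) \<in> carrier (tensor_algebra A {x})"
  by (rule site_algebras.simple_tensor_closed) auto

lemma embed_closed: "a \<in> carrier (A x) \<Longrightarrow> embed x a \<in> carrier AA"
  unfolding embed_def by (intro local_hom singleton_Fin_Z site_tensor_closed)

text \<open>Only the slot \<open>x\<close> matters. This reconciles the operations of the fixed
  algebra \<open>A x\<close> with the slot-dependent operations of \<open>A i\<close> in the tensor
  lemmas.\<close>

lemma simple_tensor_site_cong: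
  "f x = g x \<Longrightarrow> simple_tensor A {x} f = simple_tensor A {x} g"
  by (auto simp: simple_tensor_def intro!: arg_cong[of _ _ basis_vec] arg_cong[of _ _ "tensor_class A {x}"])

lemma embed_mult:
  assumes "a \<in> carrier (A x)" "b \<in> carrier (A x)"
  shows "embed x (a \<otimes>\<^bsub>A x\<^esub> b) = embed x a \<otimes>\<^bsub>AA\<^esub> embed x b"
proof -
  have "simple_tensor A {x} (\<lambda>_. a \<otimes>\<^bsub>A x\<^esub> b) = simple_tensor A {x} (\<lambda>i. a \<otimes>\<^bsub>A i\<^esub> b)"
    by (rule simple_tensor_site_cong) simp
  also have "\<dots> = simple_tensor A {x} (\<lambda>_. a) \<otimes>\<^bsub>tensor_algebra A {x}\<^esub> simple_tensor A {x} (\<lambda>_. b)"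
    using assms by (intro site_algebras.simple_tensor_mult[symmetric]) auto
  finally show ?thesis
    using assms by (simp add: embed_def local_hom singleton_Fin_Z site_tensor_closed)
qed

lemma embed_one: "embed x \<one>\<^bsub>A x\<^esub> = \<one>\<^bsub>AA\<^esub>"
proof -
  have "simple_tensor A {x} (\<lambda>_. \<one>\<^bsub>A x\<^esub>) = simple_tensor A {x} (\<lambda>i. \<one>\<^bsub>A i\<^esub>)"
    by (rule simple_tensor_site_cong) simp
  then show ?thesis
    by (simp add: embed_def site_algebras.simple_tensor_one local_hom singleton_Fin_Z)
qed

lemma embed_smult:
  assumes "a \<in> carrier (A x)"
  shows "embed x (c \<odot>\<^bsub>A x\<^esub> a) = c \<odot>\<^bsub>AA\<^esub> embed x a"
proof -
  have "simple_tensor A {x} (\<lambda>_. c \<odot>\<^bsub>A x\<^esub> a) =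
      simple_tensor A {x} ((\<lambda>_. a)(x := c \<odot>\<^bsub>A x\<^esub> a))"
    by (rule simple_tensor_site_cong) simp
  also have "\<dots> = c \<odot>\<^bsub>tensor_algebra A {x}\<^esub> simple_tensor A {x} (\<lambda>_. a)"
    using assms by (intro site_algebras.simple_tensor_smult[symmetric]) auto
  finally show ?thesis
    using assms by (simp add: embed_def local_hom singleton_Fin_Z site_tensor_closed)
qed

lemma embed_adj:
  assumes "a \<in> carrier (A x)"
  shows "embed x (adj (A x) a) = adj AA (embed x a)"
proof -
  have "simple_tensor A {x} (\<lambda>_. adj (A x) a) = simple_tensor A {x} (\<lambda>i. adj (A i) a)"
    by (rule simple_tensor_site_cong) simp
  also have "\<dots> = adj (tensor_algebra A {x}) (simple_tensor A {x} (\<lambda>_. a))"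
    using assms by (intro site_algebras.simple_tensor_adj[symmetric]) auto
  finally show ?thesis
    using assms by (simp add: embed_def local_hom singleton_Fin_Z site_tensor_closed)
qed

text \<open>Compatibility places both elements in the tensor product over \<open>{x, y}\<close>,
  where in every slot at least one of the two factors is a unit.\<close>

lemma embed_commute:
  assumes "x \<noteq> y" and a: "a \<in> carrier (A x)" and b: "b \<in> carrier (A y)"
  shows "embed x a \<otimes>\<^bsub>AA\<^esub> embed y b = embed y b \<otimes>\<^bsub>AA\<^esub> embed x a"
proof -
  let ?\<Lambda> = "{x, y}"
  let ?f = "\<lambda>z. \<lambda>a i. if i \<in> {z} then a else \<one>\<^bsub>A i\<^esub>"
  have \<Lambda>: "?\<Lambda> \<in> Fin_Z" by (simp add: Fin_Z_def)
  have e: "embed z d = \<phi> ?\<Lambda> (simple_tensor A ?\<Lambda> (?f z d))"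
    if "z \<in> ?\<Lambda>" "d \<in> carrier (A z)" for z d
  proof -
    have "embed z d = \<phi> ?\<Lambda> (insert_units A ?\<Lambda> {z} (simple_tensor A {z} (\<lambda>_. d)))"
      unfolding embed_def using that \<Lambda>
      by (intro compatible[symmetric] singleton_Fin_Z site_tensor_closed) auto
    also have "insert_units A ?\<Lambda> {z} (simple_tensor A {z} (\<lambda>_. d)) = simple_tensor A ?\<Lambda> (?f z d)"
      using that by (intro site_algebras.insert_units_simple_tensor) auto
    finally show ?thesis .
  qed
  have one: "\<one>\<^bsub>A i\<^esub> \<in> carrier (A i)" for i
    by (rule ring.ring_simprules(6)[OF site_algebras.family_ring])
  have cf: "?f x a i \<in> carrier (A i)" "?f y b i \<in> carrier (A i)" for i
    using a b one by auto
  have slots: "?f x a i \<otimes>\<^bsub>A i\<^esub> ?f y b i = ?f y b i \<otimes>\<^bsub>A i\<^esub> ?f x a i" for i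
    using a b one \<open>x \<noteq> y\<close> by (auto simp: ring.ring_simprules(12)[OF site_algebras.family_ring]
        monoid.r_one[OF ring.is_monoid[OF site_algebras.family_ring]])
  have "embed x a \<otimes>\<^bsub>AA\<^esub> embed y b =
      \<phi> ?\<Lambda> (simple_tensor A ?\<Lambda> (\<lambda>i. ?f x a i \<otimes>\<^bsub>A i\<^esub> ?f y b i))"
    using a b cf
    by (simp only: e insertI1 insert_iff local_hom(2)[OF \<Lambda>, symmetric]
        site_algebras.simple_tensor_closed site_algebras.simple_tensor_mult simp_thms)
  also have "\<dots> = \<phi> ?\<Lambda> (simple_tensor A ?\<Lambda> (\<lambda>i. ?f y b i \<otimes>\<^bsub>A i\<^esub> ?f x a i))"
    by (simp only: slots)
  also have "\<dots> = embed y b \<otimes>\<^bsub>AA\<^esub> embed x a"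
    using a b cf
    by (simp only: e insertI1 insert_iff local_hom(2)[OF \<Lambda>, symmetric]
        site_algebras.simple_tensor_closed site_algebras.simple_tensor_mult simp_thms)
  finally show ?thesis .
qed

definition site_spin :: "nat \<Rightarrow> int \<Rightarrow> 'b" where
  "site_spin \<kappa> x = inv_into (carrier (A x)) (\<xi> x) (pauli \<kappa>)"

lemma spin_eq_embed: "spin A \<xi> \<phi> \<kappa> x = embed x (site_spin \<kappa> x)"
  by (simp add: spin_def embed_def site_spin_def)

lemma site_hom:
  shows "inj_on (\<xi> x) (carrier (A x))" and "\<xi> x ` carrier (A x) = UNIV"
    and "\<lbrakk>a \<in> carrier (A x); b \<in> carrier (A x)\<rbrakk> \<Longrightarrow> \<xi> x (a \<otimes>\<^bsub>A x\<^esub> b) = \<xi> x a ** \<xi> x b"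
    and "\<xi> x \<one>\<^bsub>A x\<^esub> = mat 1"
    and "a \<in> carrier (A x) \<Longrightarrow> \<xi> x (c \<odot>\<^bsub>A x\<^esub> a) = (\<chi> i j. c * \<xi> x a $ i $ j)"
    and "a \<in> carrier (A x) \<Longrightarrow> \<xi> x (adj (A x) a) = (\<chi> i j. cnj (\<xi> x a $ j $ i))"
  using site_iso[of x]
  by (auto simp: star_iso_def star_hom_def ring_hom_def complex_matrices_def bij_betw_def)

lemma site_spin_closed: "site_spin \<kappa> x \<in> carrier (A x)"
  unfolding site_spin_def by (rule inv_into_into) (simp add: site_hom(2))

lemma site_spin_pauli: "\<xi> x (site_spin \<kappa> x) = pauli \<kappa>"
  unfolding site_spin_def by (rule f_inv_into_f) (simp add: site_hom(2))

lemma site_eqI: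
  "\<lbrakk>\<xi> x a = \<xi> x b; a \<in> carrier (A x); b \<in> carrier (A x)\<rbrakk> \<Longrightarrow> a = b"
  using site_hom(1)[of x] by (auto dest: inj_onD)

text \<open>Relations at one site are checked on Pauli matrices, pulled back along the injective
  \<xi> and pushed forward by \<open>embed\<close>; relations between sites come from
  \<open>embed_commute\<close>.\<close>

lemma spin_system: "spin_system AA (spin A \<xi> \<phi>)"
proof
  note R = ring.ring_simprules[OF site_algebras.family_ring]
  note cl = site_spin_closed R(5,6) site_algebras.family_smult_closed
    unital_star_algebra.adj_closed[OF site_algebras.family_algebra]
  fix \<kappa> \<mu> :: nat and x y :: int
  show "spin A \<xi> \<phi> \<kappa> x \<in> carrier AA"
    by (simp add: spin_eq_embed embed_closed site_spin_closed)
  have "adj (A x) (site_spin \<kappa> x) = site_spin \<kappa> x"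
    by (rule site_eqI[of x]) (simp_all add: cl site_hom site_spin_pauli pauli_adj)
  then show "adj AA (spin A \<xi> \<phi> \<kappa> x) = spin A \<xi> \<phi> \<kappa> x"
    by (simp add: spin_eq_embed embed_adj[symmetric] site_spin_closed)
  have "site_spin \<kappa> x \<otimes>\<^bsub>A x\<^esub> site_spin \<kappa> x = \<one>\<^bsub>A x\<^esub>"
    by (rule site_eqI[of x]) (simp_all add: cl site_hom site_spin_pauli pauli_square)
  then show "spin A \<xi> \<phi> \<kappa> x \<otimes>\<^bsub>AA\<^esub> spin A \<xi> \<phi> \<kappa> x = \<one>\<^bsub>AA\<^esub>"
    by (simp add: spin_eq_embed embed_mult[symmetric] site_spin_closed embed_one)
  {
    assume "\<kappa> \<in> {1, 2, 3}" "\<mu> \<in> {1, 2, 3}" "\<kappa> \<noteq> \<mu>"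
    from pauli_anticommute[OF this]
    have "site_spin \<kappa> x \<otimes>\<^bsub>A x\<^esub> site_spin \<mu> x =
        (- 1) \<odot>\<^bsub>A x\<^esub> (site_spin \<mu> x \<otimes>\<^bsub>A x\<^esub> site_spin \<kappa> x)"
      by (intro site_eqI[of x]) (simp_all add: cl site_hom site_spin_pauli)
    then show "spin A \<xi> \<phi> \<kappa> x \<otimes>\<^bsub>AA\<^esub> spin A \<xi> \<phi> \<mu> x =
        (- 1) \<odot>\<^bsub>AA\<^esub> (spin A \<xi> \<phi> \<mu> x \<otimes>\<^bsub>AA\<^esub> spin A \<xi> \<phi> \<kappa> x)"
      by (simp add: spin_eq_embed embed_mult[symmetric] embed_smult[symmetric] cl)
  next
    assume "x \<noteq> y"
    then show "spin A \<xi> \<phi> \<kappa> x \<otimes>\<^bsub>AA\<^esub> spin A \<xi> \<phi> \<mu> y = spin A \<xi> \<phi> \<mu> y \<otimes>\<^bsub>AA\<^esub> spin A \<xi> \<phi> \<kappa> x"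
      by (simp add: spin_eq_embed embed_commute site_spin_closed)
  }
qed

end

section \<open>Two by two matrices over an algebra\<close>

lemma mat2_eqI:
  "\<lbrakk>X $ 1 $ 1 = a; X $ 1 $ 2 = b; X $ 2 $ 1 = c; X $ 2 $ 2 = d\<rbrakk> \<Longrightarrow> X = mat2 a b c d"
  by (simp add: vec_eq_iff forall_2 mat2_def)

text \<open>The extension alters only the norm and the carrier of the matrix algebra, so all
  computations may take place in \<open>matrices_over\<close>.\<close>

lemma extended_algebra_simps:
  "carrier (extended_algebra M \<Theta>) =
    {mat2 a b (\<Theta> b) (\<Theta> a) | a b. a \<in> carrier M \<and> b \<in> carrier M}"
  "mult (extended_algebra M \<Theta>) = mult (matrices_over M)"
  "one (extended_algebra M \<Theta>) = one (matrices_over M)"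
  "zero (extended_algebra M \<Theta>) = zero (matrices_over M)"
  "add (extended_algebra M \<Theta>) = add (matrices_over M)"
  "smult (extended_algebra M \<Theta>) = smult (matrices_over M)"
  "adj (extended_algebra M \<Theta>) = adj (matrices_over M)"
  by (simp_all add: extended_algebra_def cstar_of_def add_nrm_def)

lemma mat2_ops:
  "mat2 a b c d \<oplus>\<^bsub>matrices_over M\<^esub> mat2 a' b' c' d' =
    mat2 (a \<oplus>\<^bsub>M\<^esub> a') (b \<oplus>\<^bsub>M\<^esub> b') (c \<oplus>\<^bsub>M\<^esub> c') (d \<oplus>\<^bsub>M\<^esub> d')"
  "k \<odot>\<^bsub>matrices_over M\<^esub> mat2 a b c d =
    mat2 (k \<odot>\<^bsub>M\<^esub> a) (k \<odot>\<^bsub>M\<^esub> b) (k \<odot>\<^bsub>M\<^esub> c) (k \<odot>\<^bsub>M\<^esub> d)"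
  "adj (matrices_over M) (mat2 a b c d) = mat2 (adj M a) (adj M c) (adj M b) (adj M d)"
  "one (matrices_over M) = mat2 \<one>\<^bsub>M\<^esub> \<zero>\<^bsub>M\<^esub> \<zero>\<^bsub>M\<^esub> \<one>\<^bsub>M\<^esub>"
  "zero (matrices_over M) = mat2 \<zero>\<^bsub>M\<^esub> \<zero>\<^bsub>M\<^esub> \<zero>\<^bsub>M\<^esub> \<zero>\<^bsub>M\<^esub>"
  by (rule mat2_eqI; simp add: matrices_over_def mat2_def)+

lemma mat2_mult:
  assumes "ring M" "a \<in> carrier M" "b \<in> carrier M" "c \<in> carrier M" "d \<in> carrier M"
    "a' \<in> carrier M" "b' \<in> carrier M" "c' \<in> carrier M" "d' \<in> carrier M"
  shows "mat2 a b c d \<otimes>\<^bsub>matrices_over M\<^esub> mat2 a' b' c' d' =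
    mat2 (a \<otimes>\<^bsub>M\<^esub> a' \<oplus>\<^bsub>M\<^esub> b \<otimes>\<^bsub>M\<^esub> c') (a \<otimes>\<^bsub>M\<^esub> b' \<oplus>\<^bsub>M\<^esub> b \<otimes>\<^bsub>M\<^esub> d')
      (c \<otimes>\<^bsub>M\<^esub> a' \<oplus>\<^bsub>M\<^esub> d \<otimes>\<^bsub>M\<^esub> c') (c \<otimes>\<^bsub>M\<^esub> b' \<oplus>\<^bsub>M\<^esub> d \<otimes>\<^bsub>M\<^esub> d')"
proof -
  interpret ring M by fact
  have sum: "(\<Oplus>\<^bsub>M\<^esub>k\<in>(UNIV :: 2 set). f k) = f 1 \<oplus>\<^bsub>M\<^esub> f 2"
    if "\<And>k. f k \<in> carrier M" for f
    using that by (simp add: UNIV_2 Pi_def)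
  have "(\<Oplus>\<^bsub>M\<^esub>k\<in>UNIV. mat2 a b c d $ i $ k \<otimes>\<^bsub>M\<^esub> mat2 a' b' c' d' $ k $ j) =
      mat2 a b c d $ i $ 1 \<otimes>\<^bsub>M\<^esub> mat2 a' b' c' d' $ 1 $ j \<oplus>\<^bsub>M\<^esub>
      mat2 a b c d $ i $ 2 \<otimes>\<^bsub>M\<^esub> mat2 a' b' c' d' $ 2 $ j" for i j :: 2
    using assms by (intro sum) (auto simp: mat2_def)
  then show ?thesis
    by (intro mat2_eqI) (simp_all add: matrices_over_def)
qed

section \<open>Off-diagonal fermion matrices\<close>

context spin_system
begin

text \<open>This is \<open>T\<close> times \<psi> of \<open>fermion c x\<close> written out, with
  the half rotation already replaced by its sign; it needs no \<Theta>.\<close>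

definition fermion_matrix :: "complex \<Rightarrow> int \<Rightarrow> 'a^2^2" where
  "fermion_matrix c x = mat2 \<zero> (string_sign x \<odot> fermion c x) (fermion c x) \<zero>"

lemma signed_fermion_closed: "string_sign x \<odot> fermion c x \<in> carrier M"
  by (simp add: scalar_closed)

text \<open>Transposition swaps the corners. The sign from \<open>fermion_adj\<close> appears in the
  upper one and cancels the existing sign in the lower one, so the shape is preserved.\<close>

lemma fermion_matrix_adj:
  "adj (matrices_over M) (fermion_matrix c x) = fermion_matrix (cnj c) x"
proof -
  have "adj M \<zero> = \<zero>"
    using adj_smult[of \<zero> 0] by (simp add: scalar_zero adj_closed)
  then show ?thesis
    by (simp add: fermion_matrix_def mat2_ops adj_smult fermion_adj scalar_scalar scalar_one
        string_sign_square) (simp add: string_sign_def scalar_scalar scalar_one)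
qed

text \<open>Products of off-diagonal matrices are diagonal, and the two diagonal entries are the two
  preceding anticommutator identities.\<close>

lemma fermion_matrix_anticommutator:
  "fermion_matrix c x \<otimes>\<^bsub>matrices_over M\<^esub> fermion_matrix d y \<oplus>\<^bsub>matrices_over M\<^esub>
    fermion_matrix d y \<otimes>\<^bsub>matrices_over M\<^esub> fermion_matrix c x =
    (if x = y then (1 + c * d) / 2 else 0) \<odot>\<^bsub>matrices_over M\<^esub> \<one>\<^bsub>matrices_over M\<^esub>"
proof -
  have [simp]: "k \<odot> \<zero> = \<zero>" for k :: complex
    using smult_r_null[of k] by (simp add: carrier_class)
  have "fermion_matrix c x \<otimes>\<^bsub>matrices_over M\<^esub> fermion_matrix d y \<oplus>\<^bsub>matrices_over M\<^esub>
      fermion_matrix d y \<otimes>\<^bsub>matrices_over M\<^esub> fermion_matrix c x =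
    mat2 ((string_sign x \<odot> fermion c x) \<otimes> fermion d y \<oplus> (string_sign y \<odot> fermion d y) \<otimes> fermion c x)
      \<zero> \<zero>
      (fermion c x \<otimes> (string_sign y \<odot> fermion d y) \<oplus> fermion d y \<otimes> (string_sign x \<odot> fermion c x))"
    by (simp add: fermion_matrix_def mat2_mult ring_M mat2_ops signed_fermion_closed)
  then show ?thesis
    by (simp only: fermion_anticommutator fermion_anticommutator' mat2_ops) simp
qed

end

section \<open>The half rotation and the operators of the theorem\<close>

locale rotated_spin_system = spin_system M s
  for M :: "'a cstar_alg" (structure) and s +
  fixes \<Theta> :: "'a \<Rightarrow> 'a"
  assumes rotation: "half_rotation M s \<Theta>"
begin

lemma rotation_hom:
  shows "x \<in> carrier M \<Longrightarrow> \<Theta> x \<in> carrier M"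
    and "\<lbrakk>x \<in> carrier M; y \<in> carrier M\<rbrakk> \<Longrightarrow> \<Theta> (x \<oplus> y) = \<Theta> x \<oplus> \<Theta> y"
    and "\<lbrakk>x \<in> carrier M; y \<in> carrier M\<rbrakk> \<Longrightarrow> \<Theta> (x \<otimes> y) = \<Theta> x \<otimes> \<Theta> y"
    and "\<Theta> \<one> = \<one>"
    and "x \<in> carrier M \<Longrightarrow> \<Theta> (c \<odot> x) = c \<odot> \<Theta> x"
  using rotation by (auto simp: half_rotation_def star_iso_def star_hom_def ring_hom_def)

lemma rotation_zero: "\<Theta> \<zero> = \<zero>"
  using rotation_hom(5)[of \<zero> 0] rotation_hom(1)[of \<zero>] by (simp add: scalar_zero)

lemma rotation_spin:
  assumes "\<kappa> \<in> {1, 2, 3}"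
  shows "\<Theta> (s \<kappa> x) = (if \<kappa> = 3 then 1 else string_sign x) \<odot> s \<kappa> x"
proof -
  have "\<Theta> (s \<kappa> x) = (if x \<ge> 1 then s \<kappa> x else spin_sign \<kappa> \<odot> s \<kappa> x)"
    using rotation assms unfolding half_rotation_def by blast
  then show ?thesis
    using assms by (auto simp: spin_sign_def string_sign_def scalar_one spin_closed)
qed

lemma rotation_string: "\<Theta> (string xs) = string xs"
  by (induction xs)
    (simp_all add: string_Nil string_Cons rotation_hom rotation_spin spin_closed scalar_one)

text \<open>Both spins in the ladder element acquire the same sign, so it factors out whatever
  \<open>c\<close> is.\<close>

lemma rotation_ladder: "\<Theta> (ladder c x) = string_sign x \<odot> ladder c x"
  using rotation_spin[of 1 x] rotation_spin[of 2 x]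
  by (simp add: ladder_def rotation_hom spin_closed scalar_closed scalar_add_right scalar_scalar
      mult_ac)

lemma rotation_fermion: "\<Theta> (fermion c x) = string_sign x \<odot> fermion c x"
  by (simp add: fermion_def rotation_hom rotation_string rotation_ladder smult_mult_right)

lemma spin_string_eq: "spin_string M s x = string (string_sites x)"
  by (auto simp: spin_string_def string_def string_sites_def list_prod_def)

lemma spin_plus_eq: "spin_plus M s x = ladder \<i> x"
  by (simp add: spin_plus_def ladder_def)

lemma spin_minus_eq: "spin_minus M s x = ladder (- \<i>) x"
proof -
  have "(- \<i>) \<odot> s 2 x = \<ominus> (\<i> \<odot> s 2 x)"
    using scalar_minus[of "\<i> \<odot> s 2 x"] by (simp add: scalar_closed spin_closed scalar_scalar)
  then show ?thesis by (simp add: spin_minus_def ladder_def a_minus_def)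
qed

text \<open>Left multiplication by \<open>T\<close> swaps the rows of the diagonal matrix.\<close>

lemma flip_psi:
  assumes "a \<in> carrier M"
  shows "ext_T M \<otimes>\<^bsub>extended_algebra M \<Theta>\<^esub> ext_psi M \<Theta> a = mat2 \<zero> (\<Theta> a) a \<zero>"
  using assms by (simp add: extended_algebra_simps ext_T_def ext_psi_def mat2_mult ring_M rotation_hom)

lemma flip_psi_fermion:
  "ext_T M \<otimes>\<^bsub>extended_algebra M \<Theta>\<^esub> ext_psi M \<Theta> (spin_string M s x \<otimes> ladder c x) =
    fermion_matrix c x"
  by (simp add: spin_string_eq flip: fermion_def)
    (simp add: flip_psi rotation_fermion fermion_matrix_def)

lemma annihilation_eq: "annihilation M \<Theta> s x = fermion_matrix (- \<i>) x"
  by (simp add: annihilation_def spin_minus_eq flip_psi_fermion)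

lemma creation_eq: "creation M \<Theta> s x = fermion_matrix \<i> x"
  by (simp add: creation_def annihilation_eq extended_algebra_simps fermion_matrix_adj)

lemma fermion_matrix_closed: "fermion_matrix c x \<in> carrier (extended_algebra M \<Theta>)"
proof -
  \<comment> \<open>The upper right entry is the witness: \<Theta> contributes a second copy of the
    sign, and the two cancel in the lower left entry.\<close>
  let ?b = "string_sign x \<odot> fermion c x"
  have "\<Theta> ?b = fermion c x"
    by (simp add: rotation_hom rotation_fermion scalar_scalar string_sign_square scalar_one)
  then have "fermion_matrix c x = mat2 \<zero> ?b (\<Theta> ?b) (\<Theta> \<zero>)"
    by (simp add: fermion_matrix_def rotation_zero)
  then show ?thesis
    unfolding extended_algebra_simps using signed_fermion_closed[of x c] by auto
qed

end

theorem proposition35: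
  fixes A :: "int \<Rightarrow> 'b cstar_alg"
    and \<xi> :: "int \<Rightarrow> 'b \<Rightarrow> complex^2^2"
    and AA :: "'a cstar_alg"
    and L :: "int set \<Rightarrow> 'a set"
    and \<phi> :: "int set \<Rightarrow> ((int \<Rightarrow> 'b) \<Rightarrow> complex) set \<Rightarrow> 'a"
    and \<Theta> :: "'a \<Rightarrow> 'a"
    and \<sigma> :: "nat \<Rightarrow> int \<Rightarrow> 'a"
    and x y :: int
  assumes "spin_algebra A \<xi> AA L \<phi>"
    and "\<sigma> = spin A \<xi> \<phi>"
    and "half_rotation AA \<sigma> \<Theta>"
  shows "annihilation AA \<Theta> \<sigma> x \<in> carrier (extended_algebra AA \<Theta>) \<and>
         creation AA \<Theta> \<sigma> x \<in> carrier (extended_algebra AA \<Theta>) \<and>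
         creation AA \<Theta> \<sigma> x = ext_T AA \<otimes>\<^bsub>extended_algebra AA \<Theta>\<^esub>
           ext_psi AA \<Theta> (spin_string AA \<sigma> x \<otimes>\<^bsub>AA\<^esub> spin_plus AA \<sigma> x) \<and>
         anticommutator (extended_algebra AA \<Theta>)
           (annihilation AA \<Theta> \<sigma> x) (annihilation AA \<Theta> \<sigma> y) = \<zero>\<^bsub>extended_algebra AA \<Theta>\<^esub> \<and>
         anticommutator (extended_algebra AA \<Theta>)
           (annihilation AA \<Theta> \<sigma> x) (creation AA \<Theta> \<sigma> y) =
         (if x = y then 1 else 0) \<odot>\<^bsub>extended_algebra AA \<Theta>\<^esub> \<one>\<^bsub>extended_algebra AA \<Theta>\<^esub>"
proof -
  interpret rotated_spin_system AA \<sigma> \<Theta>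
    using assms spin_algebra.spin_system
    by (intro rotated_spin_system.intro rotated_spin_system_axioms.intro) auto
  let ?N = "matrices_over AA :: ('a^2^2) star_alg"
  \<comment> \<open>For two annihilators \<open>c d = - 1\<close>, so their anticommutator is the
    zero multiple of the unit even if \<open>x = y\<close>. For annihilator and creator
    \<open>c d = 1\<close>, which gives the Kronecker delta.\<close>
  have "0 \<odot>\<^bsub>?N\<^esub> \<one>\<^bsub>?N\<^esub> = \<zero>\<^bsub>?N\<^esub>"
    by (simp add: mat2_ops scalar_zero)
  then show ?thesis
    by (simp add: fermion_matrix_closed annihilation_eq creation_eq spin_plus_eq
        flip_psi_fermion[unfolded extended_algebra_simps(2)] anticommutator_def extended_algebra_simps(2-6)
        fermion_matrix_anticommutator)
qed

end
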